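(* Let $\lambda\ge 0$. The $\lambda^+$-biased edge-reinforced random walk on $\mathbb{Z}$ is recurrent for $0\le\lambda\le 1$ and transient for $\lambda>1$.
   Context: The $\lambda^+$-biased edge-reinforced random walk on $\mathbb{Z}$ (edge-reinforced random walk with initial additive bias $\lambda\ge0$) is the nearest-neighbour process $(X_n)_{n\ge0}$ with $X_0=0$ and $$\mathbb{P}[X_{n+1}=x_n+1\mid X_n=x_n,\dots,X_0=x_0]=\frac{\lambda+w(n,x_n)}{\lambda+w(n,x_n)+w(n,x_n-1)},$$ and $X_{n+1}=x_n-1$ otherwise, where $w(n,z)$ is the weight of the edge $\{z,z+1\}$ at time $n$: $$w(n,z)=w(0,z)+\sum_{i=0}^{n-1}\left(\mathbf{1}_{X_i=z,\,X_{i+1}=z+1}+\mathbf{1}_{X_i=z+1,\,X_{i+1}=z}\right),\qquad w(0,z)=1\text{ for all }z\in\mathbb{Z}.$$ Recurrent means that almost surely the starting node $0$ is visited infinitely often; transient means that almost surely every node is visited only finitely often. *)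

theory Defs
  imports "HOL-Probability.Probability"
begin

text \<open>The edge \<open>{z, z + 1}\<close> is identified by its left endpoint \<open>z\<close>.
  The weight is a function of a deterministic path \<open>x\<close> and depends only on \<open>x 0, \<dots>, x n\<close>.\<close>

definition edge_weight :: "(nat \<Rightarrow> int) \<Rightarrow> nat \<Rightarrow> int \<Rightarrow> real" where
  "edge_weight x n z =
     1 + (\<Sum>i<n. of_bool (x i = z \<and> x (Suc i) = z + 1) + of_bool (x i = z + 1 \<and> x (Suc i) = z))"

text \<open>The transition law is only imposed for histories of positive probability, since
  \<^const>\<open>cond_prob\<close> is \<open>0\<close> (division by zero) on the others.\<close>

locale biased_errw = prob_space M for M :: "'a measure" +
  fixes lam :: real and X :: "nat \<Rightarrow> 'a \<Rightarrow> int"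
  assumes measurable_X: "\<And>n. X n \<in> measurable M (count_space UNIV)"
    and start: "AE \<omega> in M. X 0 \<omega> = 0"
    and nearest_neighbour: "\<And>n. AE \<omega> in M. X (Suc n) \<omega> = X n \<omega> + 1 \<or> X (Suc n) \<omega> = X n \<omega> - 1"
    and transition: "\<And>n x. \<P>(\<omega> in M. \<forall>i\<le>n. X i \<omega> = x i) > 0 \<Longrightarrow>
      \<P>(\<omega> in M. X (Suc n) \<omega> = x n + 1 \<bar> \<forall>i\<le>n. X i \<omega> = x i) =
        (lam + edge_weight x n (x n)) /
        (lam + edge_weight x n (x n) + edge_weight x n (x n - 1))"

definition recurrent :: "'a measure \<Rightarrow> (nat \<Rightarrow> 'a \<Rightarrow> int) \<Rightarrow> bool" where
  "recurrent M X \<longleftrightarrow> (AE \<omega> in M. infinite {n. X n \<omega> = 0})"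

definition transient :: "'a measure \<Rightarrow> (nat \<Rightarrow> 'a \<Rightarrow> int) \<Rightarrow> bool" where
  "transient M X \<longleftrightarrow> (AE \<omega> in M. \<forall>z. finite {n. X n \<omega> = z})"

end

theory Submission
  imports Defs
begin

text \<open>Since \<open>\<int>\<close> is a tree, the walk performs independent Polya urns at the sites, so it has the
  law of a random walk in a random environment: from \<open>z\<close> it steps to the right with
  probability \<open>p\<^sub>z\<close>, where the \<open>p\<^sub>z\<close> are independent and Beta distributed with parameters
  \<open>((\<lambda>+1)/2, 1)\<close> for \<open>z > 0\<close> and \<open>((\<lambda>+2)/2, 1/2)\<close> for \<open>z < 0\<close>. With
  \<open>\<rho>\<^sub>z = (1-p\<^sub>z)/p\<^sub>z\<close>, the walk in a fixed environment is recurrent if neither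
  \<open>\<rho>\<^sub>1\<cdots>\<rho>\<^sub>n\<close> nor \<open>1/(\<rho>\<^bsub>-1\<^esub>\<cdots>\<rho>\<^bsub>-n\<^esub>)\<close> tends to 0, and transient if
  \<open>\<Sum>\<^sub>n \<rho>\<^sub>1\<cdots>\<rho>\<^sub>n < \<infinity>\<close>. For Beta parameters \<open>a \<noteq> b\<close>, strict log-convexity of the Gamma
  function gives \<open>E \<rho>\<^bsup>(a-b)/2\<^esup> = B((a+b)/2, (a+b)/2) / B(a, b) < 1\<close>, which decides the
  behaviour of the products; the critical case \<open>a = b\<close> (that is, \<open>\<lambda> = 1\<close>) follows from
  symmetry and the zero-one law.\<close>

subsection \<open>Nearest-neighbour chains in a fixed environment\<close>

text \<open>\<open>visit_prob p z j m x\<close> is the probability that the chain started at \<open>x\<close> visits \<open>z\<close> at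
  least \<open>j\<close> times during the times \<open>0, \<dots>, m\<close>, defined by conditioning on the first step.\<close>

fun visit_prob :: "(int \<Rightarrow> real) \<Rightarrow> int \<Rightarrow> nat \<Rightarrow> nat \<Rightarrow> int \<Rightarrow> real" where
  "visit_prob p z 0 m x = 1"
| "visit_prob p z (Suc j) 0 x = of_bool (x = z \<and> j = 0)"
| "visit_prob p z (Suc j) (Suc m) x =
     p x * visit_prob p z (if x = z then j else Suc j) m (x + 1) +
     (1 - p x) * visit_prob p z (if x = z then j else Suc j) m (x - 1)"

text \<open>Moving the base point by one drops a single nonzero factor \<open>r (y + 1)\<close>, so
  summability does not depend on the base point. One condition on the products from 0 thus serves
  every site \<open>z\<close>.\<close>

lemma summable_products_shift:
  fixes r :: "int \<Rightarrow> real"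
  assumes r: "\<And>x. r x \<noteq> 0" and summable: "summable (\<lambda>n. \<Prod>i=1..n. r (int i))"
  shows "summable (\<lambda>n. \<Prod>i=1..n. r (z + int i))"
proof -
  have step: "summable (\<lambda>n. \<Prod>i=1..n. r (y + int i)) \<longleftrightarrow>
      summable (\<lambda>n. \<Prod>i=1..n. r (y + 1 + int i))" for y
  proof -
    have "(\<Prod>i=1..Suc n. r (y + int i)) = r (y + 1) * (\<Prod>i=1..n. r (y + 1 + int i))" for n
      by (simp add: prod.atLeast_Suc_atMost prod.shift_bounds_cl_Suc_ivl add_ac del: prod.cl_ivl_Suc)
    then show ?thesis
      using r by (subst summable_Suc_iff[symmetric]) (simp del: prod.cl_ivl_Suc)
  qed
  show ?thesis
  proof (induction z rule: int_induct[where k = 0])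
    case base
    show ?case using summable by simp
  next
    case (step1 i)
    then show ?case using step by blast
  next
    case (step2 i)
    then show ?case using step[of "i - 1"] by simp
  qed
qed

locale interior_probs =
  fixes p :: "int \<Rightarrow> real"
  assumes pos: "0 < p x" and less_1: "p x < 1"
begin

lemma nonneg: "0 \<le> p x" and le_1: "p x \<le> 1"
  using pos[of x] less_1[of x] by auto

lemma visit_prob_bounds: "visit_prob p z j m x \<in> {0..1}"
proof (induction m arbitrary: j x)
  case 0
  show ?case by (cases j) auto
next
  case (Suc m)
  show ?case
  proof (cases j)
    case j: (Suc i)
    show ?thesis
      using convexD[OF convex_closed_interval Suc.IH Suc.IH, of "p x" "1 - p x"] nonneg le_1
      unfolding j visit_prob.simps(3) by simp
  qed simp
qed

lemma visit_prob_Suc_mono: "visit_prob p z j m x \<le> visit_prob p z j (Suc m) x"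
proof (induction m arbitrary: j x)
  case 0
  show ?case
  proof (cases j)
    case (Suc i)
    show ?thesis
    proof (cases "x = z \<and> i = 0")
      case False
      then show ?thesis
        using visit_prob_bounds[of z j "Suc 0" x] by (auto simp: Suc simp del: visit_prob.simps(3))
    qed (simp add: Suc)
  qed simp
next
  case (Suc m)
  show ?case
  proof (cases j)
    case j: (Suc i)
    show ?thesis
      unfolding j visit_prob.simps(3) by (intro add_mono mult_left_mono Suc.IH) (use nonneg le_1 in auto)
  qed simp
qed

text \<open>The harmonic equation multiplies successive increments of \<open>g\<close> by
  \<open>(1 - p x) / p x\<close>, so \<open>g n\<close> is \<open>g 1\<close> times a partial sum of
  odds products. Boundedness with \<open>g 1 > 0\<close> would make these products summable, hence
  null. The intended \<open>g\<close> is the probability of never reaching 0.\<close>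

lemma harmonic_half_line_eq_0:
  fixes g :: "int \<Rightarrow> real"
  assumes harmonic: "\<And>x. x \<ge> 1 \<Longrightarrow> g x = p x * g (x + 1) + (1 - p x) * g (x - 1)"
    and g: "g 0 = 0" "\<And>x. 0 \<le> g x" "\<And>x. g x \<le> 1"
    and rho: "\<not> (\<lambda>n. \<Prod>i=1..n. (1 - p (int i)) / p (int i)) \<longlonglongrightarrow> 0"
  shows "g (int n) = 0"
proof -
  define a where "a n = (\<Prod>i=1..n. (1 - p (int i)) / p (int i))" for n
  have a_nonneg: "a n \<ge> 0" for n
    unfolding a_def by (intro prod_nonneg) (simp add: nonneg le_1)
  have incr: "g (int n + 1) - g (int n) = g 1 * a n" for n
  proof (induction n)
    case 0
    show ?case by (simp add: a_def g)
  next
    case (Suc n)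
    let ?x = "int n + 1"
    have p: "p ?x > 0" by (rule pos)
    have "p ?x * (g (?x + 1) - g ?x) = (1 - p ?x) * (g ?x - g (?x - 1))"
      using harmonic[of ?x] by (simp add: algebra_simps)
    also have "\<dots> = (1 - p ?x) * (g 1 * a n)"
      using Suc by simp
    finally have "g (?x + 1) - g ?x = g 1 * ((1 - p ?x) / p ?x * a n)"
      using p by (simp add: field_simps)
    then show ?case
      by (simp add: a_def prod.nat_ivl_Suc' add_ac)
  qed
  have sum: "g (int n) = g 1 * (\<Sum>k<n. a k)" for n
  proof (induction n)
    case (Suc n)
    then show ?case using incr[of n] by (simp add: algebra_simps)
  qed (simp add: g)
  have "g 1 = 0"
  proof (rule ccontr)
    assume "g 1 \<noteq> 0"
    then have g1: "g 1 > 0" using g(2)[of 1] by linarith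
    have "summable a"
    proof (rule summableI_nonneg_bounded[OF a_nonneg])
      fix n show "(\<Sum>k<n. a k) \<le> 1 / g 1"
        using sum[of n] g(3)[of "int n"] g1 by (simp add: field_simps)
    qed
    then show False
      using summable_LIMSEQ_zero rho unfolding a_def by blast
  qed
  then show ?thesis using sum by simp
qed

text \<open>The limit \<open>h\<close> of the hitting probabilities is harmonic off 0 and equals 1
  at 0. So \<open>1 - h\<close> is bounded and vanishes at 0, and the half-line lemma makes it
  vanish on both sides.\<close>

lemma visit_prob_tendsto_1:
  assumes right: "\<not> (\<lambda>n. \<Prod>i=1..n. (1 - p (int i)) / p (int i)) \<longlonglongrightarrow> 0"
    and left: "\<not> (\<lambda>n. \<Prod>i=1..n. p (- int i) / (1 - p (- int i))) \<longlonglongrightarrow> 0"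
  shows "(\<lambda>m. visit_prob p 0 1 m x) \<longlonglongrightarrow> 1"
proof -
  define h where "h x = lim (\<lambda>m. visit_prob p 0 1 m x)" for x
  have lim: "(\<lambda>m. visit_prob p 0 1 m x) \<longlonglongrightarrow> h x" for x
  proof -
    have "convergent (\<lambda>m. visit_prob p 0 1 m x)"
    proof (rule Bseq_monoseq_convergent)
      show "Bseq (\<lambda>m. visit_prob p 0 1 m x)"
        using visit_prob_bounds[of 0 1 _ x] by (intro BseqI'[of _ 1]) auto
      show "monoseq (\<lambda>m. visit_prob p 0 1 m x)"
        using visit_prob_Suc_mono by (intro incseq_imp_monoseq incseq_SucI)
    qed
    then show ?thesis unfolding h_def by (simp add: convergent_LIMSEQ_iff)
  qed
  have harmonic: "h x = p x * h (x + 1) + (1 - p x) * h (x - 1)" if "x \<noteq> 0" for x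
  proof -
    have "(\<lambda>m. visit_prob p 0 1 (Suc m) x) \<longlonglongrightarrow> p x * h (x + 1) + (1 - p x) * h (x - 1)"
      using that lim by (auto intro!: tendsto_intros)
    with LIMSEQ_Suc[OF lim[of x]] show ?thesis by (rule LIMSEQ_unique)
  qed
  define g where "g x = 1 - h x" for x
  have harmonic_g: "g x = p x * g (x + 1) + (1 - p x) * g (x - 1)" if "x \<noteq> 0" for x
    unfolding g_def harmonic[OF that] by (simp add: algebra_simps)
  have "visit_prob p 0 1 m 0 = 1" for m by (cases m) auto
  then have "h 0 = 1" unfolding h_def by simp
  then have g0: "g 0 = 0" unfolding g_def by simp
  have "h x \<in> {0..1}" for x
    by (rule closed_sequentially[OF _ _ lim]) (use visit_prob_bounds in auto)
  then have g_bounds: "0 \<le> g x" "g x \<le> 1" for x unfolding g_def by auto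
  have "g x = 0"
  proof (cases "x \<ge> 0")
    case True
    then show ?thesis
      using harmonic_half_line_eq_0[OF harmonic_g g0 g_bounds right, of "nat x"] by simp
  next
    case False
    \<comment> \<open>Reflection at 0 swaps the two step probabilities; the odds of the mirrored
      chain are the factors in \<open>left\<close>.\<close>
    interpret mirror: interior_probs "\<lambda>x. 1 - p (- x)"
      by standard (use pos less_1 in auto)
    have "g (- int n) = 0" for n
    proof (rule mirror.harmonic_half_line_eq_0[where g = "\<lambda>x. g (- x)"])
      fix x :: int assume "x \<ge> 1"
      then show "g (- x) = (1 - p (- x)) * g (- (x + 1)) + (1 - (1 - p (- x))) * g (- (x - 1))"
        using harmonic_g[of "- x"] \<open>x \<ge> 1\<close>
        by (simp add: minus_diff_commute[of x 1] add.commute)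
    qed (use g0 g_bounds left in auto)
    from this[of "nat (- x)"] show ?thesis using False by simp
  qed
  then have "h x = 1" unfolding g_def by simp
  with lim[of x] show ?thesis by simp
qed

text \<open>The tail sums of the scale function, cut off at \<open>z\<close>, are superharmonic, and their
  defect at \<open>z\<close> bounds the number of visits.\<close>

lemma visit_prob_bound:
  assumes summable: "summable (\<lambda>n. \<Prod>i=1..n. (1 - p (int i)) / p (int i))"
  shows "\<exists>C. \<forall>j m x. real j * visit_prob p z j m x \<le> C"
proof -
  define a where "a n = (\<Prod>i=1..n. (1 - p (z + int i)) / p (z + int i))" for n
  have a_nonneg: "a n \<ge> 0" for n
    unfolding a_def by (intro prod_nonneg) (simp add: nonneg le_1)
  have a_summable: "summable a"
    unfolding a_def
    by (rule summable_products_shift[OF _ summable]) (use pos less_1 in \<open>auto simp: less_le\<close>)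
  have a_Suc: "p (z + int (Suc n)) * a (Suc n) = (1 - p (z + int (Suc n))) * a n" for n
    using pos[of "z + int (Suc n)"] by (simp add: a_def prod.nat_ivl_Suc')
  \<comment> \<open>Right of \<open>z\<close> this is a tail of the scale series; since
    \<open>nat\<close> truncates, it stays constant left of \<open>z\<close>.\<close>
  define f where "f x = (\<Sum>n. a (n + nat (x - z)))" for x
  have f_nonneg: "f x \<ge> 0" for x
    unfolding f_def by (intro suminf_nonneg summable_ignore_initial_segment a_summable a_nonneg)
  have f_left: "f x = f z" if "x \<le> z" for x
    using that by (simp add: f_def)
  have f_right: "f (z + int n) = a n + f (z + int n + 1)" for n
    using suminf_split_head[OF summable_ignore_initial_segment[OF a_summable, of n]]
    by (simp add: f_def nat_add_distrib add_ac)
  have f_le: "f x \<le> f z" for x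
  proof (cases "x \<le> z")
    case False
    have "f (z + int n) \<le> f z" for n
    proof (induction n)
      case (Suc n)
      then show ?case using f_right[of n] a_nonneg[of n] by (simp add: add_ac)
    qed simp
    from this[of "nat (x - z)"] show ?thesis using False by simp
  qed (use f_left[of x] in simp)
  \<comment> \<open>At \<open>z\<close> the head term \<open>a 0 = 1\<close> gives \<open>f\<close>
    the drift \<open>- p z\<close>; elsewhere \<open>f\<close> is harmonic.\<close>
  have super: "p x * f (x + 1) + (1 - p x) * f (x - 1) + p z * of_bool (x = z) \<le> f x" for x
  proof -
    consider "x < z" | "x = z" | n where "x = z + int (Suc n)"
      by (meson linorder_neqE zless_iff_Suc_zadd)
    then show ?thesis
    proof cases
      case 1
      then have "f (x + 1) = f x" "f (x - 1) = f x"
        using f_left[of "x + 1"] f_left[of "x - 1"] f_left[of x] by auto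
      then show ?thesis using 1 by (simp add: algebra_simps)
    next
      case 2
      have "f z = 1 + f (z + 1)" using f_right[of 0] by (simp add: a_def)
      then show ?thesis using 2 f_left[of "z - 1"] by (simp add: algebra_simps)
    next
      case (3 n)
      have f: "f (x + 1) = f x - a (Suc n)" "f (x - 1) = f x + a n"
        using f_right[of "Suc n"] f_right[of n] 3 by (auto simp: add_ac)
      have "p x * a (Suc n) = (1 - p x) * a n"
        using a_Suc[of n] 3 by simp
      then have "p x * f (x + 1) + (1 - p x) * f (x - 1) = f x"
        unfolding f by (simp add: algebra_simps)
      then show ?thesis using 3 by simp
    qed
  qed
  \<comment> \<open>This is Markov's inequality for the number of visits, proved directly:
    \<open>f\<close> is a potential from which each visit to \<open>z\<close> withdraws
    \<open>p z\<close>.\<close>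
  have "p z * (real j * visit_prob p z j m x) \<le> f x" for j m x
  proof (induction m arbitrary: j x)
    case 0
    show ?case
    proof (cases j)
      case (Suc i)
      \<comment> \<open>Dropping these terms from \<open>super\<close> leaves
        \<open>f z \<ge> p z\<close>, which pays for a visit at time 0.\<close>
      have "p z * f (z + 1) \<ge> 0" "(1 - p z) * f (z - 1) \<ge> 0"
        by (simp_all add: f_nonneg nonneg le_1)
      then have "f z \<ge> p z"
        using super[of z] by simp
      then show ?thesis using Suc f_nonneg by (auto simp: f_nonneg)
    qed (simp add: f_nonneg)
  next
    case (Suc m)
    show ?case
    proof (cases j)
      case j: (Suc i)
      define k where "k = (if x = z then i else Suc i)"
      let ?v = "visit_prob p z k m"
      have v: "visit_prob p z j (Suc m) x = p x * ?v (x + 1) + (1 - p x) * ?v (x - 1)"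
        unfolding j k_def by simp
      have v1: "visit_prob p z j (Suc m) x \<le> 1" using visit_prob_bounds by auto
      \<comment> \<open>A required visit is used up exactly when \<open>x = z\<close>; bounding its
        probability by 1 charges at most the defect \<open>p z\<close> in
        \<open>super\<close>.\<close>
      have "real j = real k + of_bool (x = z)" by (simp add: j k_def)
      then have "p z * (real j * visit_prob p z j (Suc m) x) =
          p z * (real k * visit_prob p z j (Suc m) x) +
          p z * of_bool (x = z) * visit_prob p z j (Suc m) x"
        by (simp add: algebra_simps)
      also have "\<dots> \<le> p z * (real k * visit_prob p z j (Suc m) x) + p z * of_bool (x = z)"
        using v1 nonneg[of z] le_1[of z] by (auto intro!: mult_left_le)
      also have "p z * (real k * visit_prob p z j (Suc m) x) =
          p x * (p z * (real k * ?v (x + 1))) + (1 - p x) * (p z * (real k * ?v (x - 1)))"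
        unfolding v by (simp add: algebra_simps)
      also have "\<dots> \<le> p x * f (x + 1) + (1 - p x) * f (x - 1)"
        using nonneg le_1 by (intro add_mono mult_left_mono Suc.IH) auto
      finally show ?thesis using super[of x] by linarith
    qed (simp add: f_nonneg)
  qed
  then have "real j * visit_prob p z j m x \<le> f z / p z" for j m x
    using order_trans[OF _ f_le, of "p z * (real j * visit_prob p z j m x)" x] pos[of z]
    by (simp add: pos_le_divide_eq mult.commute)
  then show ?thesis by blast
qed

end

subsection \<open>Beta distributions\<close>

definition beta_measure :: "real \<Rightarrow> real \<Rightarrow> real measure" where
  "beta_measure a b = density lborel
     (\<lambda>u. ennreal (indicator {0<..<1} u * (u powr (a - 1) * (1 - u) powr (b - 1)) / Beta a b))"

lemma sets_beta_measure [measurable_cong, simp]: "sets (beta_measure a b) = sets borel"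
  and space_beta_measure [simp]: "space (beta_measure a b) = UNIV"
  by (simp_all add: beta_measure_def)

lemma measurable_beta_measure [simp]: "measurable (beta_measure a b) N = measurable borel N"
  by (rule measurable_cong_sets) simp_all

lemma Beta_real_pos: "0 < a \<Longrightarrow> 0 < b \<Longrightarrow> 0 < Beta a (b::real)"
  by (simp add: Beta_def)

text \<open>The integrand only shifts the exponents of the density. Real exponents are allowed:
  integer ones give path probabilities, fractional ones the moments of the odds.\<close>

lemma nn_integral_beta_measure_powr:
  assumes "0 < a" "0 < b" "0 < a + s" "0 < b + t"
  shows "(\<integral>\<^sup>+u. ennreal (u powr s * (1 - u) powr t) \<partial>beta_measure a b) =
    ennreal (Beta (a + s) (b + t) / Beta a b)"
proof -
  have B: "0 < Beta a b" using assms by (intro Beta_real_pos)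
  let ?f = "\<lambda>u::real. u powr (a + s - 1) * (1 - u) powr (b + t - 1)"
  have "(\<integral>\<^sup>+u. ennreal (u powr s * (1 - u) powr t) \<partial>beta_measure a b) =
      (\<integral>\<^sup>+u. ennreal (1 / Beta a b) * ennreal (indicator {0<..<1} u * ?f u) \<partial>lborel)"
    unfolding beta_measure_def
  proof (subst nn_integral_density, goal_cases)
    case 3
    show ?case
    proof (intro nn_integral_cong)
      fix u :: real
      show "ennreal (indicator {0<..<1} u * (u powr (a - 1) * (1 - u) powr (b - 1)) / Beta a b) *
          ennreal (u powr s * (1 - u) powr t) =
        ennreal (1 / Beta a b) * ennreal (indicator {0<..<1} u * ?f u)"
        using B by (cases "u \<in> {0<..<1}")
          (simp_all add: ennreal_mult[symmetric] powr_add powr_diff field_simps)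
    qed
  qed measurable
  also have "\<dots> = ennreal (1 / Beta a b) * (\<integral>\<^sup>+u. ennreal (indicator {0<..<1} u * ?f u) \<partial>lborel)"
    by (rule nn_integral_cmult) measurable
  also have "(\<integral>\<^sup>+u. ennreal (indicator {0<..<1} u * ?f u) \<partial>lborel) =
      ennreal (Beta (a + s) (b + t))"
  proof -
    have "(?f has_integral Beta (a + s) (b + t)) {0<..<1}"
      using has_integral_Beta_real[of "a + s" "b + t"] assms
      by (simp add: has_integral_Icc_iff_Ioo)
    from nn_integral_has_integral_lebesgue[OF _ this] show ?thesis
      by simp
  qed
  finally show ?thesis
    using B by (simp add: ennreal_mult[symmetric] Beta_real_pos assms less_imp_le)
qed

lemma AE_beta_measure: "AE u in beta_measure a b. u \<in> {0<..<1}"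
  unfolding beta_measure_def by (subst AE_density) (auto simp: indicator_def)

lemma prob_space_beta_measure: "0 < a \<Longrightarrow> 0 < b \<Longrightarrow> prob_space (beta_measure a b)"
proof
  assume ab: "0 < a" "0 < b"
  have "emeasure (beta_measure a b) (space (beta_measure a b)) =
      (\<integral>\<^sup>+u. 1 \<partial>beta_measure a b)"
    by simp
  also have "\<dots> = (\<integral>\<^sup>+u. ennreal (u powr 0 * (1 - u) powr 0) \<partial>beta_measure a b)"
    by (intro nn_integral_cong_AE eventually_mono[OF AE_beta_measure]) auto
  also have "\<dots> = 1"
    using ab Beta_real_pos[of a b] by (subst nn_integral_beta_measure_powr) auto
  finally show "emeasure (beta_measure a b) (space (beta_measure a b)) = 1" .
qed

text \<open>With equal parameters the density is invariant under \<open>u \<mapsto> 1 - u\<close>.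
  This is the symmetry used in the critical case.\<close>

lemma beta_measure_reflect:
  assumes "A \<in> sets borel"
  shows "emeasure (beta_measure a a) ((\<lambda>u. 1 - u) -` A) = emeasure (beta_measure a a) A"
proof -
  let ?d = "\<lambda>u::real. ennreal (indicator {0<..<1} u * (u powr (a - 1) * (1 - u) powr (a - 1)) / Beta a a)"
  have [measurable]: "A \<in> sets borel" by fact
  have "(\<lambda>u. 1 - u) -` A \<inter> space borel \<in> sets borel"
    by (rule measurable_sets[of _ _ borel]) measurable
  then have [measurable]: "(\<lambda>u. 1 - u) -` A \<in> sets borel" by simp
  have "emeasure (beta_measure a a) ((\<lambda>u. 1 - u) -` A) =
      (\<integral>\<^sup>+u. ?d u * indicator ((\<lambda>u. 1 - u) -` A) u \<partial>lborel)"
    unfolding beta_measure_def by (rule emeasure_density) auto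
  also have "\<dots> = (\<integral>\<^sup>+u. ?d (1 + - 1 * u) * indicator ((\<lambda>u. 1 - u) -` A) (1 + - 1 * u) \<partial>lborel)"
    by (subst nn_integral_real_affine[where c = "- 1" and t = 1]) auto
  also have "\<dots> = (\<integral>\<^sup>+u. ?d u * indicator A u \<partial>lborel)"
    by (intro nn_integral_cong) (auto simp: indicator_def mult.commute)
  also have "\<dots> = emeasure (beta_measure a a) A"
    unfolding beta_measure_def by (rule emeasure_density[symmetric]) auto
  finally show ?thesis .
qed

text \<open>Both sides have the denominator \<open>Gamma (a + b)\<close>. The numerators are
  compared along \<open>t \<mapsto> ln_Gamma (c + t) + ln_Gamma (c - t)\<close>, which strictly
  increases because \<open>Digamma\<close> does.\<close>

lemma Beta_mean_less:
  assumes "0 < a" "0 < b" "a \<noteq> (b::real)"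
  shows "Beta ((a + b) / 2) ((a + b) / 2) < Beta a b"
proof -
  have main: "Beta ((a + b) / 2) ((a + b) / 2) < Beta a b" if "0 < a" "a < b" for a b :: real
  proof -
    define c d where "c = (a + b) / 2" and "d = (b - a) / 2"
    have cd: "0 < d" "d < c" using that by (auto simp: c_def d_def field_simps)
    define F where "F t = ln_Gamma (c + t) + ln_Gamma (c - t)" for t
    have "F 0 < F d"
    proof (rule DERIV_pos_imp_increasing_open[OF cd(1)])
      fix t assume t: "0 < t" "t < d"
      have "(F has_real_derivative Digamma (c + t) - Digamma (c - t)) (at t)"
        unfolding F_def using t cd by (auto intro!: derivative_eq_intros)
      moreover have "Digamma (c - t) < Digamma (c + t)"
        using t cd by (intro Digamma_real_strict_mono) auto
      ultimately show "\<exists>y. DERIV F t :> y \<and> 0 < y" by (metis diff_gt_0_iff_gt)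
    next
      show "continuous_on {0..d} F"
        unfolding F_def
      proof (intro continuous_on_add)
        show "continuous_on {0..d} (\<lambda>t. ln_Gamma (c + t))" "continuous_on {0..d} (\<lambda>t. ln_Gamma (c - t))"
          using cd by (auto intro!: DERIV_continuous_on derivative_eq_intros)
      qed
    qed
    moreover have "c + d = b" "c - d = a" by (auto simp: c_def d_def field_simps)
    ultimately have "ln (Gamma c) + ln (Gamma c) < ln (Gamma b) + ln (Gamma a)"
      using cd that by (simp add: F_def ln_Gamma_real_pos)
    moreover have G: "0 < Gamma a" "0 < Gamma b" "0 < Gamma c"
      using cd that by (auto intro!: Gamma_real_pos)
    ultimately have "ln (Gamma c * Gamma c) < ln (Gamma b * Gamma a)"
      by (subst (1 2) ln_mult) auto
    then have "Gamma c * Gamma c < Gamma b * Gamma a"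
      using G by (subst (asm) ln_less_cancel_iff) auto
    moreover have "c + c = a + b" by (simp add: c_def)
    ultimately show ?thesis
      using that by (simp add: Beta_def c_def[symmetric] divide_strict_right_mono mult.commute)
  qed
  show ?thesis
    using main[of a b] main[of b a] assms
    by (cases "a < b") (auto simp: Beta_commute add.commute)
qed

subsection \<open>Products of odds in a Beta environment\<close>

text \<open>Clipping makes every environment an element of \<open>(0, 1)\<^sup>\<int>\<close>, so that the null set of bad
  environments never has to be excluded.\<close>

definition clip :: "real \<Rightarrow> real" where
  "clip u = (if 0 < u \<and> u < 1 then u else 1 / 2)"

lemma clip_pos: "0 < clip u" and clip_less_1: "clip u < 1"
  by (auto simp: clip_def)

lemma clip_bounds: "0 \<le> clip u" "clip u \<le> 1"
  using clip_pos[of u] clip_less_1[of u] by auto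

lemma clip_measurable [measurable]: "clip \<in> borel_measurable borel"
  unfolding clip_def by measurable

text \<open>The odds of a left step, not of a right one.\<close>

definition odds :: "(int \<Rightarrow> real) \<Rightarrow> int \<Rightarrow> real" where
  "odds \<omega> z = (1 - clip (\<omega> z)) / clip (\<omega> z)"

lemma odds_pos: "0 < odds \<omega> z"
  using clip_pos clip_less_1 by (simp add: odds_def)

text \<open>As \<open>t < 0\<close>, \<open>P n < 1\<close> forces
  \<open>P n powr t \<ge> 1 \<ge> q ^ n\<close>, so the quotient could not be null.\<close>

lemma not_tendsto_0_if_powr_null:
  fixes P :: "nat \<Rightarrow> real"
  assumes "\<And>n. 0 < P n" "t < 0" "0 < q" "q < 1"
    and null: "(\<lambda>n. P n powr t / q ^ n) \<longlonglongrightarrow> 0"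
  shows "\<not> P \<longlonglongrightarrow> 0"
proof
  assume "P \<longlonglongrightarrow> 0"
  then have "eventually (\<lambda>n. P n < 1) sequentially"
    by (rule order_tendstoD) simp
  moreover have "eventually (\<lambda>n. P n powr t / q ^ n < 1) sequentially"
    using null by (rule order_tendstoD) simp
  ultimately have "eventually (\<lambda>n::nat. False) sequentially"
  proof eventually_elim
    case (elim n)
    have "1 \<le> P n powr t"
      using elim(1) assms(1)[of n] assms(2) powr_mono2'[of t "P n" 1] by simp
    moreover have "q ^ n \<le> 1" "0 < q ^ n" using assms by (auto intro: power_le_one)
    ultimately show False using elim(2) by (simp add: field_simps)
  qed
  then show False by simp
qed

text \<open>Once the quotient is below 1, taking the power \<open>1 / t\<close> dominates
  \<open>P n\<close> by a geometric sequence.\<close>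

lemma summable_if_powr_null:
  fixes P :: "nat \<Rightarrow> real"
  assumes P: "\<And>n. 0 < P n" and t: "0 < t" and q: "0 < q" "q < 1"
    and null: "(\<lambda>n. P n powr t / q ^ n) \<longlonglongrightarrow> 0"
  shows "summable P"
proof -
  have "eventually (\<lambda>n. P n powr t / q ^ n < 1) sequentially"
    using null by (rule order_tendstoD) simp
  then have "eventually (\<lambda>n. norm (P n) \<le> (q powr (1 / t)) ^ n) sequentially"
  proof eventually_elim
    case (elim n)
    then have "P n powr t \<le> q ^ n" using q by (simp add: field_simps)
    then have "(P n powr t) powr (1 / t) \<le> (q ^ n) powr (1 / t)"
      using t by (intro powr_mono2) auto
    then show ?case
      using P[of n] t q by (simp add: powr_powr powr_power powr_realpow[symmetric] mult.commute)
  qed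
  moreover have "summable (\<lambda>n. (q powr (1 / t)) ^ n)"
    using q t powr_less_mono2[of "1 / t" q 1] by (intro summable_geometric) simp
  ultimately show ?thesis by (rule summable_comparison_test_ev)
qed

section \<open>Independent Beta environments and the zero-one law\<close>

locale beta_environment =
  fixes a b :: "int \<Rightarrow> real"
  assumes a_pos: "0 < a z" and b_pos: "0 < b z"
begin

sublocale product_prob_space "\<lambda>z. beta_measure (a z) (b z)" UNIV
  by (rule product_prob_spaceI) (rule prob_space_beta_measure[OF a_pos b_pos])

definition env :: "(int \<Rightarrow> real) measure" where
  "env = PiM UNIV (\<lambda>z. beta_measure (a z) (b z))"

sublocale env: prob_space env
  unfolding env_def by (rule P.prob_space_axioms)

lemma space_env [simp]: "space env = UNIV"
  by (simp add: env_def space_PiM)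

lemma coordinate_measurable [measurable]: "(\<lambda>\<omega>. \<omega> z) \<in> borel_measurable env"
proof -
  have "(\<lambda>\<omega>. \<omega> z) \<in> measurable env (beta_measure (a z) (b z))"
    unfolding env_def by measurable
  then show ?thesis by (simp cong: measurable_cong_sets)
qed

lemma distr_coordinate: "distr env borel (\<lambda>\<omega>. \<omega> z) = beta_measure (a z) (b z)"
  using PiM_component[of z] unfolding env_def
  by (simp cong: distr_cong)

lemma indep_coordinates:
  fixes f :: "nat \<Rightarrow> int"
  assumes "inj f"
  shows "env.indep_vars (\<lambda>_. borel) (\<lambda>n \<omega>. \<omega> (f n)) UNIV"
proof (subst env.indep_vars_iff_distr_eq_PiM)
  let ?N = "\<lambda>z. beta_measure (a z) (b z)"
  have "distr env (Pi\<^sub>M UNIV (\<lambda>_. borel)) (\<lambda>\<omega>. \<lambda>n\<in>UNIV. \<omega> (f n)) =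
      distr (PiM UNIV ?N) (Pi\<^sub>M UNIV (\<lambda>n. ?N (f n))) (\<lambda>\<omega>. \<lambda>n\<in>UNIV. \<omega> (f n))"
    unfolding env_def by (intro distr_cong sets_PiM_cong refl) simp_all
  also have "\<dots> = PiM UNIV (\<lambda>n. ?N (f n))"
    using assms by (intro distr_PiM_reindex prob_space) auto
  finally show "distr env (Pi\<^sub>M UNIV (\<lambda>_. borel)) (\<lambda>\<omega>. \<lambda>n\<in>UNIV. \<omega> (f n)) =
      PiM UNIV (\<lambda>n. distr env borel (\<lambda>\<omega>. \<omega> (f n)))"
    by (simp add: distr_coordinate)
qed auto

text \<open>The integrand depends only on the coordinates in \<open>S\<close>, so the integral
  reduces to a finite product measure, where Fubini applies.\<close>

lemma nn_integral_env_prod: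
  fixes g :: "int \<Rightarrow> real \<Rightarrow> ennreal"
  assumes "finite S" and [measurable]: "\<And>z. g z \<in> borel_measurable borel"
  shows "(\<integral>\<^sup>+\<omega>. (\<Prod>z\<in>S. g z (\<omega> z)) \<partial>env) = (\<Prod>z\<in>S. \<integral>\<^sup>+u. g z u \<partial>beta_measure (a z) (b z))"
proof -
  let ?N = "\<lambda>z. beta_measure (a z) (b z)"
  have meas: "(\<lambda>\<omega>. \<Prod>z\<in>S. g z (\<omega> z)) \<in> borel_measurable (PiM S ?N)"
  proof (intro borel_measurable_prod_ennreal)
    fix z assume "z \<in> S"
    then have "(\<lambda>\<omega>. \<omega> z) \<in> measurable (PiM S ?N) (?N z)"
      by (rule measurable_component_singleton)
    then show "(\<lambda>\<omega>. g z (\<omega> z)) \<in> borel_measurable (PiM S ?N)"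
      by (rule measurable_compose) simp
  qed
  have "(\<integral>\<^sup>+\<omega>. (\<Prod>z\<in>S. g z (\<omega> z)) \<partial>env) =
      (\<integral>\<^sup>+\<omega>. (\<Prod>z\<in>S. g z (\<omega> z)) \<partial>distr (PiM UNIV ?N) (PiM S ?N) (\<lambda>x. restrict x S))"
    unfolding env_def using meas by (subst nn_integral_distr) auto
  also have "\<dots> = (\<integral>\<^sup>+\<omega>. (\<Prod>z\<in>S. g z (\<omega> z)) \<partial>PiM S ?N)"
    using assms(1) by (subst distr_PiM_restrict_finite) auto
  also have "\<dots> = (\<Prod>z\<in>S. \<integral>\<^sup>+u. g z u \<partial>?N z)"
    using assms by (intro product_nn_integral_prod) auto
  finally show ?thesis .
qed

text \<open>By \<open>Beta_mean_less\<close> the chosen fractional moment of the odds is some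
  \<open>r < 1\<close>; by independence the same moment of an \<open>n\<close>-fold product is
  \<open>r ^ n\<close>. This exponential decay is upgraded to an almost sure statement.\<close>

lemma prod_odds_powr_summable:
  fixes f :: "nat \<Rightarrow> int"
  assumes f: "inj f" and ab: "\<And>n. a (f n) = \<alpha>" "\<And>n. b (f n) = \<beta>" "\<alpha> \<noteq> \<beta>"
  shows "\<exists>q. 0 < q \<and> q < 1 \<and>
    (AE \<omega> in env. summable (\<lambda>n. (\<Prod>i<n. odds \<omega> (f i)) powr ((\<alpha> - \<beta>) / 2) / q ^ n))"
proof -
  define \<theta> where "\<theta> = (\<alpha> - \<beta>) / 2"
  define r where "r = Beta ((\<alpha> + \<beta>) / 2) ((\<alpha> + \<beta>) / 2) / Beta \<alpha> \<beta>"
  \<comment> \<open>The square root splits the decay: after division by \<open>q ^ n\<close> the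
    mean is still \<open>q ^ n\<close>, hence summable.\<close>
  define q where "q = sqrt r"
  have pos: "0 < \<alpha>" "0 < \<beta>" using a_pos[of "f 0"] b_pos[of "f 0"] by (simp_all add: ab)
  have r: "0 < r" "r < 1"
    using Beta_mean_less[OF pos ab(3)] Beta_real_pos[OF pos] pos by (auto simp: r_def Beta_real_pos)
  then have q: "0 < q" "q < 1" by (auto simp: q_def)
  define g where "g u = ((1 - clip u) / clip u) powr \<theta> / q" for u
  have g_meas [measurable]: "g \<in> borel_measurable borel" unfolding g_def by measurable
  have g_nonneg: "g u \<ge> 0" for u using q by (simp add: g_def)
  have g_integral: "(\<integral>\<^sup>+u. ennreal (g u) \<partial>beta_measure \<alpha> \<beta>) = ennreal q"
  proof -
    have "(\<integral>\<^sup>+u. ennreal (g u) \<partial>beta_measure \<alpha> \<beta>) =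
        (\<integral>\<^sup>+u. ennreal (1 / q) * ennreal (u powr (- \<theta>) * (1 - u) powr \<theta>) \<partial>beta_measure \<alpha> \<beta>)"
    proof (intro nn_integral_cong_AE eventually_mono[OF AE_beta_measure])
      fix u :: real assume u: "u \<in> {0<..<1}"
      then have "g u = 1 / q * (u powr (- \<theta>) * (1 - u) powr \<theta>)"
        by (simp add: g_def clip_def powr_divide powr_minus field_simps)
      then show "ennreal (g u) = ennreal (1 / q) * ennreal (u powr (- \<theta>) * (1 - u) powr \<theta>)"
        using q by (simp add: ennreal_mult[symmetric])
    qed
    also have "\<dots> = ennreal (1 / q) *
        (\<integral>\<^sup>+u. ennreal (u powr (- \<theta>) * (1 - u) powr \<theta>) \<partial>beta_measure \<alpha> \<beta>)"
      by (rule nn_integral_cmult) simp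
    also have "(\<integral>\<^sup>+u. ennreal (u powr (- \<theta>) * (1 - u) powr \<theta>) \<partial>beta_measure \<alpha> \<beta>) =
        ennreal (Beta (\<alpha> + - \<theta>) (\<beta> + \<theta>) / Beta \<alpha> \<beta>)"
      using pos by (intro nn_integral_beta_measure_powr) (auto simp: \<theta>_def field_simps)
    also have "\<alpha> + - \<theta> = (\<alpha> + \<beta>) / 2"
      by (simp add: \<theta>_def field_simps)
    also have "\<beta> + \<theta> = (\<alpha> + \<beta>) / 2"
      by (simp add: \<theta>_def field_simps)
    also have "ennreal (1 / q) * ennreal (Beta ((\<alpha> + \<beta>) / 2) ((\<alpha> + \<beta>) / 2) / Beta \<alpha> \<beta>) = ennreal q"
      unfolding r_def[symmetric] using q r by (simp add: ennreal_mult[symmetric] q_def real_div_sqrt)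
    finally show ?thesis .
  qed
  define h where "h n \<omega> = (\<Prod>i<n. g (\<omega> (f i)))" for n and \<omega> :: "int \<Rightarrow> real"
  have h_meas [measurable]: "h n \<in> borel_measurable env" for n unfolding h_def by measurable
  have h_nonneg: "h n \<omega> \<ge> 0" for n \<omega> unfolding h_def by (intro prod_nonneg g_nonneg ballI)
  have h_integral: "(\<integral>\<^sup>+\<omega>. ennreal (h n \<omega>) \<partial>env) = ennreal (q ^ n)" for n
  proof -
    have inj: "inj_on f {..<n}" using f by (rule inj_on_subset) simp
    have "(\<integral>\<^sup>+\<omega>. ennreal (h n \<omega>) \<partial>env) = (\<integral>\<^sup>+\<omega>. (\<Prod>z\<in>f ` {..<n}. ennreal (g (\<omega> z))) \<partial>env)"
      unfolding h_def using inj by (simp add: prod.reindex prod_ennreal g_nonneg)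
    also have "\<dots> = (\<Prod>z\<in>f ` {..<n}. \<integral>\<^sup>+u. ennreal (g u) \<partial>beta_measure (a z) (b z))"
      by (rule nn_integral_env_prod) auto
    also have "\<dots> = (\<Prod>i<n. ennreal q)"
      using inj by (simp add: prod.reindex ab g_integral)
    finally show ?thesis using q by (simp add: ennreal_power)
  qed
  \<comment> \<open>By Tonelli the series has finite mean, so it converges almost surely.\<close>
  have "(\<integral>\<^sup>+\<omega>. (\<Sum>n. ennreal (h n \<omega>)) \<partial>env) = (\<Sum>n. ennreal (q ^ n))"
    by (simp add: nn_integral_suminf h_integral)
  also have "\<dots> < \<infinity>"
    using q summable_geometric[of q] by (simp add: ennreal_suminf_neq_top less_top)
  finally have "AE \<omega> in env. (\<Sum>n. ennreal (h n \<omega>)) \<noteq> \<infinity>"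
    by (intro nn_integral_PInf_AE) auto
  then have "AE \<omega> in env. summable (\<lambda>n. h n \<omega>)"
    by (rule eventually_mono) (auto intro: summable_suminf_not_top h_nonneg)
  moreover have "h n \<omega> = (\<Prod>i<n. odds \<omega> (f i)) powr \<theta> / q ^ n" for n \<omega>
    unfolding h_def g_def odds_def[symmetric]
    by (simp add: prod_dividef prod_powr_distrib less_imp_le odds_pos)
  ultimately show ?thesis using q unfolding \<theta>_def by auto
qed

text \<open>Here the exponent \<open>(\<alpha> - \<beta>) / 2\<close> is negative, so small powers
  mean large products.\<close>

lemma AE_prod_odds_less:
  fixes f :: "nat \<Rightarrow> int"
  assumes f: "inj f" and ab: "\<And>n. a (f n) = \<alpha>" "\<And>n. b (f n) = \<beta>" "\<alpha> < \<beta>"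
  shows "AE \<omega> in env. \<not> (\<lambda>n. \<Prod>i<n. odds \<omega> (f i)) \<longlonglongrightarrow> 0"
proof -
  obtain q where q: "0 < q" "q < 1" and
    "AE \<omega> in env. summable (\<lambda>n. (\<Prod>i<n. odds \<omega> (f i)) powr ((\<alpha> - \<beta>) / 2) / q ^ n)"
    using prod_odds_powr_summable[OF f ab(1,2)] ab(3) by auto
  from this(3) show ?thesis
  proof eventually_elim
    case (elim \<omega>)
    from not_tendsto_0_if_powr_null[OF _ _ q summable_LIMSEQ_zero[OF elim]] ab(3)
    show ?case by (simp add: odds_pos prod_pos)
  qed
qed

text \<open>Here the exponent is positive, so small powers mean small products. The same power is a
  negative power of the inverse product, which gives the second part. Transience uses the first part
  on the positive sites, recurrence the second on the negative ones.\<close>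

lemma AE_prod_odds_greater:
  fixes f :: "nat \<Rightarrow> int"
  assumes f: "inj f" and ab: "\<And>n. a (f n) = \<alpha>" "\<And>n. b (f n) = \<beta>" "\<beta> < \<alpha>"
  shows "AE \<omega> in env. summable (\<lambda>n. \<Prod>i<n. odds \<omega> (f i)) \<and>
    \<not> (\<lambda>n. \<Prod>i<n. inverse (odds \<omega> (f i))) \<longlonglongrightarrow> 0"
proof -
  obtain q where q: "0 < q" "q < 1" and
    "AE \<omega> in env. summable (\<lambda>n. (\<Prod>i<n. odds \<omega> (f i)) powr ((\<alpha> - \<beta>) / 2) / q ^ n)"
    using prod_odds_powr_summable[OF f ab(1,2)] ab(3) by auto
  from this(3) show ?thesis
  proof eventually_elim
    case (elim \<omega>)
    let ?P = "\<lambda>n. \<Prod>i<n. odds \<omega> (f i)"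
    have P: "0 < ?P n" for n by (simp add: odds_pos prod_pos)
    have "inverse (?P n) powr (- ((\<alpha> - \<beta>) / 2)) = ?P n powr ((\<alpha> - \<beta>) / 2)" for n
      using P[of n] by (simp add: powr_minus inverse_powr)
    then have "\<not> (\<lambda>n. inverse (?P n)) \<longlonglongrightarrow> 0"
      using not_tendsto_0_if_powr_null[of "\<lambda>n. inverse (?P n)" "- ((\<alpha> - \<beta>) / 2)", OF _ _ q]
        summable_LIMSEQ_zero[OF elim] ab(3) P by simp
    moreover have "summable ?P"
      by (rule summable_if_powr_null[OF P _ q summable_LIMSEQ_zero[OF elim]]) (use ab(3) in simp)
    ultimately show ?case by (simp add: prod_inversef[symmetric] o_def)
  qed
qed

text \<open>The set where the products vanish is a tail event that is disjoint from its image under the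
  measure-preserving reflection \<open>u \<mapsto> 1 - u\<close>, so it is null by the zero-one law.\<close>

lemma AE_prod_odds_equal:
  fixes f :: "nat \<Rightarrow> int"
  assumes f: "inj f" and ab: "\<And>n. a (f n) = b (f n)"
  shows "AE \<omega> in env. \<not> (\<lambda>n. \<Prod>i<n. odds \<omega> (f i)) \<longlonglongrightarrow> 0"
proof -
  define L where "L u = ln ((1 - clip u) / clip u)" for u
  have [measurable]: "L \<in> borel_measurable borel" unfolding L_def by measurable
  define V where "V n \<omega> = (\<Sum>i<n. L (\<omega> (f i)))" for n and \<omega> :: "int \<Rightarrow> real"
  have V_meas [measurable]: "V n \<in> borel_measurable env" for n unfolding V_def by measurable
  \<comment> \<open>\<open>A\<close> says that the logarithms of the products tend to
    \<open>-\<infinity>\<close>, and \<open>A'\<close> that they tend to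
    \<open>+\<infinity>\<close>; natural thresholds keep both events measurable.\<close>
  define A where "A = {\<omega>. \<forall>k::nat. \<exists>m. \<forall>n\<ge>m. V n \<omega> \<le> - real k}"
  define A' where "A' = {\<omega>. \<forall>k::nat. \<exists>m. \<forall>n\<ge>m. - V n \<omega> \<le> - real k}"
  have A_sets: "A \<in> sets env"
  proof -
    have "{\<omega>\<in>space env. \<forall>k::nat. \<exists>m. \<forall>n\<ge>m. V n \<omega> \<le> - real k} \<in> sets env" by measurable
    then show ?thesis by (simp add: A_def)
  qed
  have A'_sets: "A' \<in> sets env"
  proof -
    have "{\<omega>\<in>space env. \<forall>k::nat. \<exists>m. \<forall>n\<ge>m. - V n \<omega> \<le> - real k} \<in> sets env" by measurable
    then show ?thesis by (simp add: A'_def)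
  qed
  have in_A: "\<omega> \<in> A" if "(\<lambda>n. \<Prod>i<n. odds \<omega> (f i)) \<longlonglongrightarrow> 0" for \<omega>
    unfolding A_def
  proof (clarify)
    fix k :: nat
    have P: "0 < (\<Prod>i<n. odds \<omega> (f i))" for n by (simp add: odds_pos prod_pos)
    have V: "V n \<omega> = ln (\<Prod>i<n. odds \<omega> (f i))" for n
      unfolding V_def L_def odds_def[symmetric] by (rule ln_prod[symmetric]) (auto simp: odds_pos less_imp_neq[symmetric])
    have "eventually (\<lambda>n. (\<Prod>i<n. odds \<omega> (f i)) < exp (- real k)) sequentially"
      using that by (rule order_tendstoD) simp
    then have "eventually (\<lambda>n. V n \<omega> \<le> - real k) sequentially"
    proof eventually_elim
      case (elim n)
      then have "ln (\<Prod>i<n. odds \<omega> (f i)) < ln (exp (- real k))"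
        using P[of n] by (subst ln_less_cancel_iff) auto
      then show ?case by (simp add: V)
    qed
    then show "\<exists>m. \<forall>n\<ge>m. V n \<omega> \<le> - real k" by (simp add: eventually_sequentially)
  qed
  have disjoint: "A \<inter> A' = {}"
  proof (rule ccontr)
    assume "A \<inter> A' \<noteq> {}"
    then obtain \<omega> where "\<omega> \<in> A" "\<omega> \<in> A'" by auto
    then have "\<exists>m. \<forall>n\<ge>m. V n \<omega> \<le> - real 1" "\<exists>m. \<forall>n\<ge>m. - V n \<omega> \<le> - real 1"
      unfolding A_def A'_def by blast+
    then obtain m m' where "\<forall>n\<ge>m. V n \<omega> \<le> - 1" "\<forall>n\<ge>m'. - V n \<omega> \<le> - 1" by auto
    then have "V (max m m') \<omega> \<le> - 1" "- V (max m m') \<omega> \<le> - 1" by auto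
    then show False by simp
  qed
  \<comment> \<open>Reflecting only where the parameters agree preserves the whole environment law
    and still flips every site in the range of \<open>f\<close>.\<close>
  define T where "T \<omega> z = (if a z = b z then 1 - \<omega> z else \<omega> z)" for \<omega> :: "int \<Rightarrow> real" and z
  have V_T: "V n (T \<omega>) = - V n \<omega>" for n \<omega>
  proof -
    have "L (1 - u) = - L u" for u
    proof -
      \<comment> \<open>This holds outside \<open>(0, 1)\<close> too, because the default
        \<open>1 / 2\<close> is fixed by the reflection.\<close>
      have "clip (1 - u) = 1 - clip u" by (auto simp: clip_def)
      then show ?thesis using clip_pos[of u] clip_less_1[of u] by (simp add: L_def ln_div)
    qed
    then show ?thesis by (simp add: V_def T_def ab sum_negf)
  qed
  let ?N = "\<lambda>z. beta_measure (a z) (b z)"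
  have T_meas: "T \<in> measurable env env"
  proof -
    have "(\<lambda>\<omega>. T \<omega> z) \<in> borel_measurable env" for z
      unfolding T_def by (cases "a z = b z") simp_all
    then have "(\<lambda>\<omega>. T \<omega> z) \<in> measurable env (?N z)" for z
      by (simp cong: measurable_cong_sets)
    then have "(\<lambda>\<omega> z. T \<omega> z) \<in> measurable env (PiM UNIV ?N)"
      by (intro measurable_PiM_single') auto
    then show ?thesis by (simp add: env_def)
  qed
  have "distr env env T = PiM UNIV ?N"
  proof (rule PiM_eq)
    show "sets (distr env env T) = sets (PiM UNIV ?N)" by (simp add: env_def)
  next
    fix J :: "int set" and F
    assume J: "finite J" and F: "\<And>j. j \<in> J \<Longrightarrow> F j \<in> sets (?N j)"
    define G where "G j = (if a j = b j then (\<lambda>u. 1 - u) -` F j else F j)" for j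
    have G: "G j \<in> sets borel" "emeasure (?N j) (G j) = emeasure (?N j) (F j)" if "j \<in> J" for j
    proof -
      have "(\<lambda>u. 1 - u) -` F j \<inter> space borel \<in> sets borel"
        by (rule measurable_sets[of _ _ borel]) (use F[OF that] in auto)
      then show "G j \<in> sets borel" using F[OF that] by (simp add: G_def)
      show "emeasure (?N j) (G j) = emeasure (?N j) (F j)"
        using F[OF that] by (simp add: G_def beta_measure_reflect)
    qed
    have "emeasure (distr env env T) (prod_emb UNIV ?N J (\<Pi>\<^sub>E j\<in>J. F j)) =
        emeasure env (T -` prod_emb UNIV ?N J (\<Pi>\<^sub>E j\<in>J. F j) \<inter> space env)"
      using J F by (intro emeasure_distr T_meas) (auto simp: env_def intro!: sets_PiM_I)
    also have "T -` prod_emb UNIV ?N J (\<Pi>\<^sub>E j\<in>J. F j) \<inter> space env =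
        prod_emb UNIV ?N J (\<Pi>\<^sub>E j\<in>J. G j)"
      by (auto simp: prod_emb_def G_def T_def PiE_iff split: if_splits)
    also have "emeasure env \<dots> = (\<Prod>j\<in>J. emeasure (?N j) (G j))"
      unfolding env_def using J G by (intro emeasure_PiM_emb) auto
    finally show "emeasure (distr env env T) (prod_emb UNIV ?N J (\<Pi>\<^sub>E j\<in>J. F j)) =
        (\<Prod>j\<in>J. emeasure (?N j) (F j))"
      using G by simp
  qed
  then have T_distr: "distr env env T = env" by (simp add: env_def)
  have "env.prob A = env.prob A'"
  proof -
    have "A' = T -` A \<inter> space env" by (auto simp: A_def A'_def V_T)
    then show ?thesis
      using measure_distr[OF T_meas A_sets] by (simp add: T_distr)
  qed
  then have "2 * env.prob A = env.prob (A \<union> A')"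
    using env.finite_measure_Union[OF A_sets A'_sets disjoint] by simp
  also have "\<dots> \<le> 1" by simp
  finally have "env.prob A \<noteq> 1" by simp
  moreover have "env.prob A = 0 \<or> env.prob A = 1"
  proof (rule env.kolmogorov_0_1_law)
    let ?F = "\<lambda>i. {(\<lambda>\<omega>. \<omega> (f i)) -` B \<inter> space env | B. B \<in> sets borel}"
    show "sigma_algebra (space env) (?F i)" for i
      using sets.sigma_algebra_axioms[of "vimage_algebra UNIV (\<lambda>\<omega>. \<omega> (f i)) borel"]
      by (simp add: sets_vimage_algebra2)
    show "env.indep_sets ?F UNIV"
      using indep_coordinates[OF f] unfolding env.indep_vars_def2 by simp
    \<comment> \<open>Deleting the first \<open>n\<close> summands changes the sums by the constant
      \<open>V n \<omega>\<close>, which is absorbed into the threshold \<open>k'\<close>.\<close>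
    show "A \<in> env.tail_events ?F"
      unfolding env.tail_events_def
    proof
      fix n
      define N where "N = sigma (space env) (\<Union>(?F ` {n..}))"
      have sets_N: "sets N = sigma_sets (space env) (\<Union>(?F ` {n..}))"
        unfolding N_def by (intro sets_measure_of) auto
      have space_N: "space N = UNIV" by (simp add: N_def space_measure_of_conv)
      have coord: "(\<lambda>\<omega>. \<omega> (f (n + i))) \<in> borel_measurable N" for i
      proof (rule measurableI)
        fix B :: "real set" assume "B \<in> sets borel"
        then have "(\<lambda>\<omega>. \<omega> (f (n + i))) -` B \<inter> space env \<in> ?F (n + i)" by blast
        then show "(\<lambda>\<omega>. \<omega> (f (n + i))) -` B \<inter> space N \<in> sets N"
          unfolding sets_N space_N space_env by (intro sigma_sets.Basic UN_I[of "n + i"]) auto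
      qed simp
      define W where "W m \<omega> = (\<Sum>i<m. L (\<omega> (f (n + i))))" for m and \<omega> :: "int \<Rightarrow> real"
      have W_meas [measurable]: "W m \<in> borel_measurable N" for m
        unfolding W_def using coord by measurable
      have V_W: "V (n + m) \<omega> = V n \<omega> + W m \<omega>" for m \<omega>
        unfolding V_def W_def by (induction m) (auto simp: algebra_simps)
      have "A = {\<omega>\<in>space N. \<forall>k::nat. \<exists>m. \<forall>l\<ge>m. W l \<omega> \<le> - real k}"
      proof (intro set_eqI iffI)
        fix \<omega> assume \<omega>: "\<omega> \<in> A"
        have "\<exists>m. \<forall>l\<ge>m. W l \<omega> \<le> - real k" for k
        proof -
          obtain k' :: nat where k': "real k' \<ge> real k - V n \<omega>" using real_arch_simple by blast
          obtain m where "\<forall>l\<ge>m. V l \<omega> \<le> - real k'" using \<omega> unfolding A_def by blast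
          then have "W l \<omega> \<le> - real k" if "l \<ge> m" for l
            using V_W[of l \<omega>] k' that by (smt (verit) trans_le_add2)
          then show ?thesis by blast
        qed
        then show "\<omega> \<in> {\<omega>\<in>space N. \<forall>k::nat. \<exists>m. \<forall>l\<ge>m. W l \<omega> \<le> - real k}"
          by (simp add: space_N)
      next
        fix \<omega> assume \<omega>: "\<omega> \<in> {\<omega>\<in>space N. \<forall>k::nat. \<exists>m. \<forall>l\<ge>m. W l \<omega> \<le> - real k}"
        have "\<exists>m. \<forall>l\<ge>m. V l \<omega> \<le> - real k" for k
        proof -
          obtain k' :: nat where k': "real k' \<ge> real k + V n \<omega>" using real_arch_simple by blast
          obtain m where m: "\<forall>l\<ge>m. W l \<omega> \<le> - real k'" using \<omega> by blast
          have "V l \<omega> \<le> - real k" if "l \<ge> n + m" for l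
          proof -
            have "n + (l - n) = l" "l - n \<ge> m" using that by auto
            then show ?thesis using V_W[of "l - n" \<omega>] k' m by (smt (verit))
          qed
          then show ?thesis by blast
        qed
        then show "\<omega> \<in> A" by (simp add: A_def)
      qed
      also have "\<dots> \<in> sets N" by measurable
      finally show "A \<in> sigma_sets (space env) (\<Union>(?F ` {n..}))" by (simp add: sets_N)
    qed
  qed
  ultimately have "env.prob A = 0" by blast
  then have "AE \<omega> in env. \<omega> \<notin> A"
    using A_sets by (simp add: env.prob_eq_0)
  then show ?thesis by (rule eventually_mono) (use in_A in blast)
qed

end

subsection \<open>The reinforced walk as a mixture\<close>

definition right_steps :: "(nat \<Rightarrow> int) \<Rightarrow> nat \<Rightarrow> int \<Rightarrow> nat" where
  "right_steps x n z = (\<Sum>i<n. of_bool (x i = z \<and> x (Suc i) = z + 1))"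

definition left_steps :: "(nat \<Rightarrow> int) \<Rightarrow> nat \<Rightarrow> int \<Rightarrow> nat" where
  "left_steps x n z = (\<Sum>i<n. of_bool (x i = z \<and> x (Suc i) = z - 1))"

definition step_prob :: "(int \<Rightarrow> real) \<Rightarrow> int \<Rightarrow> int \<Rightarrow> real" where
  "step_prob p y y' = (if y' = y + 1 then p y else if y' = y - 1 then 1 - p y else 0)"

definition path_prob :: "(int \<Rightarrow> real) \<Rightarrow> (nat \<Rightarrow> int) \<Rightarrow> nat \<Rightarrow> real" where
  "path_prob p x n = (\<Prod>i<n. step_prob p (x i) (x (Suc i)))"

lemma edge_weight_eq: "edge_weight x n z = 1 + right_steps x n z + left_steps x n (z + 1)"
  by (simp add: edge_weight_def right_steps_def left_steps_def sum.distrib)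

text \<open>A path on a line crosses each edge in alternating directions, so the net crossing number
  depends only on whether the edge separates 0 from the endpoint. This is what ties arrivals at a
  site to departures from it.\<close>

lemma right_steps_minus_left_steps:
  assumes "x 0 = 0" "\<And>i. i < n \<Longrightarrow> x (Suc i) = x i + 1 \<or> x (Suc i) = x i - 1"
  shows "int (right_steps x n z) - int (left_steps x n (z + 1)) =
    of_bool (0 \<le> z \<and> z < x n) - of_bool (x n \<le> z \<and> z < 0)"
  using assms(2)
proof (induction n)
  case 0
  show ?case using assms(1) by (auto simp: right_steps_def left_steps_def)
next
  case (Suc n)
  have "int (right_steps x n z) - int (left_steps x n (z + 1)) =
      of_bool (0 \<le> z \<and> z < x n) - of_bool (x n \<le> z \<and> z < 0)"
    using Suc by simp
  moreover have "int (right_steps x (Suc n) z) - int (left_steps x (Suc n) (z + 1)) =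
      int (right_steps x n z) - int (left_steps x n (z + 1)) +
      of_bool (x n = z \<and> x (Suc n) = z + 1) - of_bool (x n = z + 1 \<and> x (Suc n) = z)"
    by (simp add: right_steps_def left_steps_def)
  moreover have "x (Suc n) = x n + 1 \<or> x (Suc n) = x n - 1" using Suc.prems[of n] by simp
  ultimately show ?case
    unfolding of_bool_def by (smt (verit))
qed

text \<open>The steps are regrouped by departure site, so \<open>S\<close> has to cover the
  positions before time \<open>n\<close>; the endpoint contributes no factor.\<close>

lemma path_prob_eq_prod:
  assumes "\<And>i. i < n \<Longrightarrow> x (Suc i) = x i + 1 \<or> x (Suc i) = x i - 1" "finite S" "x ` {..<n} \<subseteq> S"
  shows "path_prob p x n = (\<Prod>z\<in>S. p z ^ right_steps x n z * (1 - p z) ^ left_steps x n z)"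
  using assms(1,3)
proof (induction n)
  case 0
  show ?case by (simp add: path_prob_def right_steps_def left_steps_def)
next
  case (Suc n)
  have x: "x (Suc n) = x n + 1 \<or> x (Suc n) = x n - 1" "x n \<in> S" using Suc.prems by auto
  have "(\<Prod>z\<in>S. p z ^ right_steps x (Suc n) z * (1 - p z) ^ left_steps x (Suc n) z) =
      (\<Prod>z\<in>S. (p z ^ right_steps x n z * (1 - p z) ^ left_steps x n z) *
         (if z = x n then step_prob p (x n) (x (Suc n)) else 1))"
    using x(1) by (intro prod.cong refl) (auto simp: right_steps_def left_steps_def step_prob_def)
  also have "\<dots> = path_prob p x n * step_prob p (x n) (x (Suc n))"
  proof -
    have "x ` {..<n} \<subseteq> S" using Suc.prems(2) by auto
    then show ?thesis
      using Suc.IH Suc.prems(1) x(2) assms(2) by (simp add: prod.distrib prod.delta)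
  qed
  finally show ?case by (simp add: path_prob_def)
qed

lemma path_prob_bounds:
  assumes "\<And>z. 0 \<le> p z" "\<And>z. p z \<le> 1"
  shows "0 \<le> path_prob p x n" "path_prob p x n \<le> 1"
  using assms unfolding path_prob_def
  by (auto intro!: prod_nonneg prod_le_1 simp: step_prob_def)

lemma interior_probs_clip: "interior_probs (\<lambda>z. clip (\<omega> z))"
  by standard (rule clip_pos clip_less_1)+

section \<open>Path probabilities averaged over the environment\<close>

context beta_environment
begin

lemma path_prob_measurable [measurable]: "(\<lambda>\<omega>. path_prob (\<lambda>z. clip (\<omega> z)) x n) \<in> borel_measurable env"
proof -
  have "(\<lambda>\<omega>. step_prob (\<lambda>z. clip (\<omega> z)) y y') \<in> borel_measurable env" for y y'
    unfolding step_prob_def by (cases "y' = y + 1"; cases "y' = y - 1") simp_all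
  then show ?thesis unfolding path_prob_def by measurable
qed

lemma visit_prob_measurable [measurable]:
  "(\<lambda>\<omega>. visit_prob (\<lambda>z. clip (\<omega> z)) z j m x) \<in> borel_measurable env"
proof (induction m arbitrary: j x)
  case 0
  show ?case by (cases j) auto
next
  case (Suc m)
  note [measurable] = Suc.IH
  show ?case by (cases j) auto
qed

text \<open>The sites are independent, and each contributes a mixed moment of its Beta law;
  \<open>clip\<close> is the identity almost everywhere.\<close>

lemma integral_path_prob:
  assumes "\<And>i. i < n \<Longrightarrow> x (Suc i) = x i + 1 \<or> x (Suc i) = x i - 1" "finite S" "x ` {..<n} \<subseteq> S"
  shows "(\<integral>\<omega>. path_prob (\<lambda>z. clip (\<omega> z)) x n \<partial>env) =
    (\<Prod>z\<in>S. Beta (a z + right_steps x n z) (b z + left_steps x n z) / Beta (a z) (b z))"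
proof -
  let ?g = "\<lambda>z u. clip u ^ right_steps x n z * (1 - clip u) ^ left_steps x n z"
  have B: "0 < Beta (a z + right_steps x n z) (b z + left_steps x n z)" "0 < Beta (a z) (b z)" for z
    using a_pos[of z] b_pos[of z] by (auto intro!: Beta_real_pos)
  have "(\<integral>\<^sup>+\<omega>. ennreal (path_prob (\<lambda>z. clip (\<omega> z)) x n) \<partial>env) =
      (\<integral>\<^sup>+\<omega>. (\<Prod>z\<in>S. ennreal (?g z (\<omega> z))) \<partial>env)"
  proof (intro nn_integral_cong)
    fix \<omega>
    show "ennreal (path_prob (\<lambda>z. clip (\<omega> z)) x n) = (\<Prod>z\<in>S. ennreal (?g z (\<omega> z)))"
      using path_prob_eq_prod[OF assms, where p = "\<lambda>z. clip (\<omega> z)"] clip_bounds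
      by (subst prod_ennreal) (auto intro: mult_nonneg_nonneg)
  qed
  also have "\<dots> = (\<Prod>z\<in>S. \<integral>\<^sup>+u. ennreal (?g z u) \<partial>beta_measure (a z) (b z))"
    using assms(2) by (rule nn_integral_env_prod) measurable
  also have "\<dots> = (\<Prod>z\<in>S. ennreal
      (Beta (a z + right_steps x n z) (b z + left_steps x n z) / Beta (a z) (b z)))"
  proof (intro prod.cong refl)
    fix z
    have "(\<integral>\<^sup>+u. ennreal (?g z u) \<partial>beta_measure (a z) (b z)) =
        (\<integral>\<^sup>+u. ennreal (u powr right_steps x n z * (1 - u) powr left_steps x n z)
          \<partial>beta_measure (a z) (b z))"
      by (intro nn_integral_cong_AE eventually_mono[OF AE_beta_measure])
        (auto simp: clip_def powr_realpow)
    also have "\<dots> = ennreal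
        (Beta (a z + right_steps x n z) (b z + left_steps x n z) / Beta (a z) (b z))"
      using a_pos[of z] b_pos[of z] by (intro nn_integral_beta_measure_powr) auto
    finally show "(\<integral>\<^sup>+u. ennreal (?g z u) \<partial>beta_measure (a z) (b z)) = \<dots>" .
  qed
  also have "\<dots> = ennreal (\<Prod>z\<in>S. Beta (a z + right_steps x n z) (b z + left_steps x n z) / Beta (a z) (b z))"
    using B by (intro prod_ennreal) (auto intro: less_imp_le)
  finally have "(\<integral>\<^sup>+\<omega>. ennreal (path_prob (\<lambda>z. clip (\<omega> z)) x n) \<partial>env) = \<dots>" .
  moreover have "0 \<le> (\<Prod>z\<in>S. Beta (a z + right_steps x n z) (b z + left_steps x n z) / Beta (a z) (b z))"
    using B by (intro prod_nonneg) (auto intro: less_imp_le)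
  moreover have "0 \<le> path_prob (\<lambda>z. clip (\<omega> z)) x n" for \<omega>
    by (rule path_prob_bounds) (rule clip_bounds)+
  ultimately show ?thesis
    by (subst integral_eq_nn_integral) auto
qed

end

text \<open>On the first visit to \<open>z \<noteq> 0\<close> the edge used for the arrival has weight 2 and the other one
  weight 1, and between two visits to \<open>z\<close> the edge used for the departure gains 2. Adding the bias
  on the right and halving gives the parameters of the Polya urn at \<open>z\<close>.\<close>

definition site_alpha :: "real \<Rightarrow> int \<Rightarrow> real" where
  "site_alpha lam z = (if 0 \<le> z then (lam + 1) / 2 else (lam + 2) / 2)"

definition site_beta :: "int \<Rightarrow> real" where
  "site_beta z = (if z \<le> 0 then 1 / 2 else 1)"

text \<open>By the net crossing count, returns over an adjacent edge equal departures over it, plus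
  one if the edge separates 0 from \<open>x n\<close>. So the weights seen at \<open>x n\<close>
  depend only on past departures from \<open>x n\<close>, as in an urn.\<close>

lemma weights_eq:
  assumes "x 0 = 0" "\<And>i. i < n \<Longrightarrow> x (Suc i) = x i + 1 \<or> x (Suc i) = x i - 1"
  shows "lam + edge_weight x n (x n) = 2 * (site_alpha lam (x n) + right_steps x n (x n))"
    and "edge_weight x n (x n - 1) = 2 * (site_beta (x n) + left_steps x n (x n))"
proof -
  have "int (left_steps x n (x n + 1)) = int (right_steps x n (x n)) + of_bool (x n < 0)"
    using right_steps_minus_left_steps[of x n "x n", OF assms] by auto
  then have "real (left_steps x n (x n + 1)) = real (right_steps x n (x n)) + of_bool (x n < 0)"
    by (simp split: split_of_bool_asm)
  then show "lam + edge_weight x n (x n) = 2 * (site_alpha lam (x n) + right_steps x n (x n))"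
    by (simp add: edge_weight_eq site_alpha_def field_simps)
  have "int (right_steps x n (x n - 1)) = int (left_steps x n (x n)) + of_bool (0 < x n)"
    using right_steps_minus_left_steps[of x n "x n - 1", OF assms] by auto
  then have "real (right_steps x n (x n - 1)) = real (left_steps x n (x n)) + of_bool (0 < x n)"
    by (simp split: split_of_bool_asm)
  then show "edge_weight x n (x n - 1) = 2 * (site_beta (x n) + left_steps x n (x n))"
    by (simp add: edge_weight_eq site_beta_def field_simps)
qed

section \<open>Identification of the law of the walk\<close>

locale errw = biased_errw +
  assumes lam_nonneg: "0 \<le> lam"
begin

sublocale E: beta_environment "site_alpha lam" site_beta
  using lam_nonneg by unfold_locales (auto simp: site_alpha_def site_beta_def)

declare measurable_X [measurable]

abbreviation history :: "(nat \<Rightarrow> int) \<Rightarrow> nat \<Rightarrow> 'a \<Rightarrow> bool" where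
  "history x n \<omega> \<equiv> \<forall>i\<le>n. X i \<omega> = x i"

text \<open>The factor 2 in \<open>weights_eq\<close> cancels and leaves the urn probabilities
  \<open>r / (r + l)\<close> and \<open>l / (r + l)\<close>; the left step is obtained as the
  complement of the right one.\<close>

lemma prob_history_Suc:
  assumes pos: "0 < \<P>(\<omega> in M. history x n \<omega>)"
    and x: "x 0 = 0" "\<And>i. i < Suc n \<Longrightarrow> x (Suc i) = x i + 1 \<or> x (Suc i) = x i - 1"
  defines "r \<equiv> site_alpha lam (x n) + right_steps x n (x n)"
    and "l \<equiv> site_beta (x n) + left_steps x n (x n)"
  shows "\<P>(\<omega> in M. history x (Suc n) \<omega>) =
    \<P>(\<omega> in M. history x n \<omega>) * ((if x (Suc n) = x n + 1 then r else l) / (r + l))"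
proof -
  have rl: "0 < r" "0 < l" using E.a_pos[of "x n"] E.b_pos[of "x n"] by (auto simp: r_def l_def)
  have "\<P>(\<omega> in M. X (Suc n) \<omega> = x n + 1 \<bar> history x n \<omega>) = (2 * r) / (2 * r + 2 * l)"
    using transition[OF pos] weights_eq(1)[of x n lam] weights_eq(2)[of x n] x by (simp add: r_def l_def)
  also have "\<dots> = r / (r + l)" using rl by (simp add: field_simps)
  finally have right: "\<P>(\<omega> in M. X (Suc n) \<omega> = x n + 1 \<and> history x n \<omega>) =
      \<P>(\<omega> in M. history x n \<omega>) * (r / (r + l))"
    using pos by (simp add: cond_prob_def field_simps)
  have "\<P>(\<omega> in M. history x n \<omega>) = prob ({\<omega>\<in>space M. X (Suc n) \<omega> = x n + 1 \<and> history x n \<omega>} \<union>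
      {\<omega>\<in>space M. X (Suc n) \<omega> = x n - 1 \<and> history x n \<omega>})"
    using nearest_neighbour[of n] by (intro finite_measure_eq_AE) (auto elim!: eventually_mono)
  also have "\<dots> = \<P>(\<omega> in M. X (Suc n) \<omega> = x n + 1 \<and> history x n \<omega>) +
      \<P>(\<omega> in M. X (Suc n) \<omega> = x n - 1 \<and> history x n \<omega>)"
    by (rule finite_measure_Union) auto
  finally have left: "\<P>(\<omega> in M. X (Suc n) \<omega> = x n - 1 \<and> history x n \<omega>) =
      \<P>(\<omega> in M. history x n \<omega>) * (l / (r + l))"
    unfolding right using rl by (simp add: field_simps)
  have "history x (Suc n) \<omega> \<longleftrightarrow> X (Suc n) \<omega> = x (Suc n) \<and> history x n \<omega>" for \<omega>
    by (auto simp: le_Suc_eq)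
  then show ?thesis
    using left right x(2)[of n] by auto
qed

text \<open>Each step changes only the factor at the current site, and the functional equation of
  \<open>Beta\<close> supplies exactly the urn probability.\<close>

lemma prob_history_eq_prod:
  assumes x: "x 0 = 0" "\<And>i. i < n \<Longrightarrow> x (Suc i) = x i + 1 \<or> x (Suc i) = x i - 1"
    and S: "finite S" "x ` {..<n} \<subseteq> S"
  shows "\<P>(\<omega> in M. history x n \<omega>) = (\<Prod>z\<in>S.
    Beta (site_alpha lam z + right_steps x n z) (site_beta z + left_steps x n z) /
    Beta (site_alpha lam z) (site_beta z))"
  using x(2) S(2)
proof (induction n)
  case 0
  have "\<P>(\<omega> in M. history x 0 \<omega>) = 1"
    using start by (subst prob_Collect_eq_1) (auto simp: x(1))
  moreover have "Beta (site_alpha lam z) (site_beta z) \<noteq> 0" for z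
    using Beta_real_pos[OF E.a_pos[of z] E.b_pos[of z]] by simp
  ultimately show ?case by (simp add: right_steps_def left_steps_def)
next
  case (Suc n)
  let ?F = "\<lambda>n z. Beta (site_alpha lam z + right_steps x n z) (site_beta z + left_steps x n z) /
    Beta (site_alpha lam z) (site_beta z)"
  have F_pos: "0 < ?F n z" for z
    using E.a_pos[of z] E.b_pos[of z] by (auto intro!: divide_pos_pos Beta_real_pos)
  have step: "x (Suc n) = x n + 1 \<or> x (Suc n) = x n - 1" "x n \<in> S"
    using Suc.prems by auto
  have "x ` {..<n} \<subseteq> S" using Suc.prems(2) by auto
  then have IH: "\<P>(\<omega> in M. history x n \<omega>) = (\<Prod>z\<in>S. ?F n z)"
    using Suc.IH Suc.prems(1) by simp
  define r l where "r = site_alpha lam (x n) + right_steps x n (x n)"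
    and "l = site_beta (x n) + left_steps x n (x n)"
  have rl: "0 < r" "0 < l" using E.a_pos[of "x n"] E.b_pos[of "x n"] by (auto simp: r_def l_def)
  have Beta_step: "Beta (r + 1) l = Beta r l * (r / (r + l))" "Beta r (l + 1) = Beta r l * (l / (r + l))"
  proof -
    have "r \<notin> \<int>\<^sub>\<le>\<^sub>0" "l \<notin> \<int>\<^sub>\<le>\<^sub>0" using rl by (auto elim!: nonpos_Ints_cases)
    then show "Beta (r + 1) l = Beta r l * (r / (r + l))" "Beta r (l + 1) = Beta r l * (l / (r + l))"
      using Beta_plus1_left[of r l] Beta_plus1_right[of l r] rl by (simp_all add: field_simps)
  qed
  \<comment> \<open>Positivity of the product is what permits the transition law, which is imposed
    only on histories of positive probability.\<close>
  have "0 < \<P>(\<omega> in M. history x n \<omega>)"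
    unfolding IH using F_pos by (intro prod_pos) auto
  from prob_history_Suc[OF this x(1) Suc.prems(1)]
  have "\<P>(\<omega> in M. history x (Suc n) \<omega>) =
      (\<Prod>z\<in>S. ?F n z) * ((if x (Suc n) = x n + 1 then r else l) / (r + l))"
    unfolding IH r_def l_def by simp
  also have "\<dots> = (\<Prod>z\<in>S. ?F n z *
      (if z = x n then (if x (Suc n) = x n + 1 then r else l) / (r + l) else 1))"
    using S(1) step(2) by (simp only: prod.distrib prod.delta if_True)
  also have "\<dots> = (\<Prod>z\<in>S. ?F (Suc n) z)"
  proof (intro prod.cong refl)
    fix z
    show "?F n z * (if z = x n then (if x (Suc n) = x n + 1 then r else l) / (r + l) else 1) =
        ?F (Suc n) z"
    proof (cases "z = x n")
      case True
      have "real (right_steps x (Suc n) (x n)) = right_steps x n (x n) + of_bool (x (Suc n) = x n + 1)"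
        "real (left_steps x (Suc n) (x n)) = left_steps x n (x n) + of_bool (x (Suc n) = x n - 1)"
        by (simp_all add: right_steps_def left_steps_def)
      then have "site_alpha lam z + right_steps x (Suc n) z = r + of_bool (x (Suc n) = x n + 1)"
        "site_beta z + left_steps x (Suc n) z = l + of_bool (x (Suc n) = x n - 1)"
        "site_alpha lam z + right_steps x n z = r" "site_beta z + left_steps x n z = l"
        by (auto simp: True r_def l_def)
      then show ?thesis
        using step(1) Beta_step True by auto
    qed (simp add: right_steps_def left_steps_def)
  qed
  finally show ?case .
qed

text \<open>For nearest-neighbour paths both sides are the same product of Beta quotients; for any
  other path both vanish.\<close>

lemma prob_history:
  assumes x0: "x 0 = 0"
  shows "\<P>(\<omega> in M. history x n \<omega>) = (\<integral>\<omega>. path_prob (\<lambda>z. clip (\<omega> z)) x n \<partial>E.env)"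
proof (cases "\<forall>i<n. x (Suc i) = x i + 1 \<or> x (Suc i) = x i - 1")
  case True
  then show ?thesis
    using prob_history_eq_prod[of x n "x ` {..<n}"] E.integral_path_prob[of n x "x ` {..<n}"] x0
    by simp
next
  case False
  then obtain i where i: "i < n" "x (Suc i) \<noteq> x i + 1" "x (Suc i) \<noteq> x i - 1" by auto
  have "AE \<omega> in M. \<not> history x n \<omega>"
    using nearest_neighbour[of i] by eventually_elim (use i in \<open>metis Suc_leI less_imp_le\<close>)
  then have "\<P>(\<omega> in M. history x n \<omega>) = 0"
    by (subst prob_Collect_eq_0) auto
  moreover have "path_prob p x n = 0" for p
    unfolding path_prob_def using i by (intro prod_zero) (auto simp: step_prob_def)
  ultimately show ?thesis by simp
qed

subsection \<open>Recurrence and transience\<close>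

abbreviation visits :: "int \<Rightarrow> nat \<Rightarrow> nat \<Rightarrow> 'a \<Rightarrow> nat" where
  "visits z k m \<omega> \<equiv> (\<Sum>i=k..k+m. of_bool (X i \<omega> = z))"

abbreviation q_path :: "(int \<Rightarrow> real) \<Rightarrow> (nat \<Rightarrow> int) \<Rightarrow> nat \<Rightarrow> real" where
  "q_path \<omega> \<equiv> path_prob (\<lambda>z. clip (\<omega> z))"

abbreviation q_visit :: "(int \<Rightarrow> real) \<Rightarrow> int \<Rightarrow> nat \<Rightarrow> nat \<Rightarrow> int \<Rightarrow> real" where
  "q_visit \<omega> \<equiv> visit_prob (\<lambda>z. clip (\<omega> z))"

lemma q_path_bounds: "q_path \<omega> x n \<in> {0..1}"
  using path_prob_bounds[of "\<lambda>z. clip (\<omega> z)"] clip_bounds by simp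

lemma q_visit_bounds: "q_visit \<omega> z j m x \<in> {0..1}"
  by (rule interior_probs.visit_prob_bounds[OF interior_probs_clip])

lemma q_integrable: "integrable E.env (\<lambda>\<omega>. q_path \<omega> x n * q_visit \<omega> z j m y)"
proof (rule E.env.integrable_const_bound[of _ 1])
  show "AE \<omega> in E.env. norm (q_path \<omega> x n * q_visit \<omega> z j m y) \<le> 1"
    using q_path_bounds[of _ x n] q_visit_bounds[of _ z j m y] by (simp add: abs_mult mult_le_one)
qed measurable

text \<open>Transfers the mixture from single paths to visit counts. The walk is not Markov, so the
  event carries the full history; the induction extends that history by one step and follows the
  recursion of \<open>visit_prob\<close>.\<close>

lemma prob_history_visits:
  assumes x0: "x 0 = 0"
  shows "\<P>(\<omega> in M. history x k \<omega> \<and> j \<le> visits z k m \<omega>) =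
    (\<integral>\<omega>. q_path \<omega> x k * q_visit \<omega> z j m (x k) \<partial>E.env)"
  using x0
proof (induction m arbitrary: j k x)
  case 0
  have "history x k \<omega> \<and> j \<le> visits z k 0 \<omega> \<longleftrightarrow>
      history x k \<omega> \<and> (j = 0 \<or> j = 1 \<and> x k = z)" for \<omega>
    by (auto simp: of_bool_def)
  then show ?case
    using prob_history[of x k, OF 0] by (cases j) auto
next
  case (Suc m)
  show ?case
  proof (cases j)
    case 0
    then show ?thesis using prob_history[of x k, OF Suc.prems] by simp
  next
    case j: (Suc i)
    \<comment> \<open>The visits still required after time \<open>k\<close>; the position at time
      \<open>k\<close> itself counts.\<close>
    define i' where "i' = (if x k = z then i else Suc i)"
    define ev where "ev y \<omega> \<longleftrightarrow> history x k \<omega> \<and> X (Suc k) \<omega> = y \<and> i' \<le> visits z (Suc k) m \<omega>" for y \<omega>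
    have split: "history x k \<omega> \<and> j \<le> visits z k (Suc m) \<omega> \<longleftrightarrow>
        history x k \<omega> \<and> i' \<le> visits z (Suc k) m \<omega>" for \<omega>
    proof (cases "history x k \<omega>")
      case True
      have "visits z k (Suc m) \<omega> = of_bool (X k \<omega> = z) + visits z (Suc k) m \<omega>"
        by (subst sum.atLeast_Suc_atMost) auto
      then show ?thesis using True by (auto simp: j i'_def)
    next
      case False
      then show ?thesis by blast
    qed
    have ev_prob: "\<P>(\<omega> in M. ev y \<omega>) =
        (\<integral>\<omega>. q_path \<omega> x k * (step_prob (\<lambda>z. clip (\<omega> z)) (x k) y * q_visit \<omega> z i' m y) \<partial>E.env)" for y
    proof -
      define x' where "x' = x(Suc k := y)"
      have x': "x' 0 = 0" "x' (Suc k) = y" using Suc.prems by (auto simp: x'_def)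
      have "history x' (Suc k) \<omega> \<longleftrightarrow> history x k \<omega> \<and> X (Suc k) \<omega> = y" for \<omega>
      proof -
        have "history x' (Suc k) \<omega> \<longleftrightarrow> (\<forall>i\<le>k. X i \<omega> = x' i) \<and> X (Suc k) \<omega> = x' (Suc k)"
          unfolding le_Suc_eq by blast
        then show ?thesis by (simp add: x'_def)
      qed
      then have "ev y \<omega> \<longleftrightarrow> history x' (Suc k) \<omega> \<and> i' \<le> visits z (Suc k) m \<omega>" for \<omega>
        by (simp only: ev_def conj_assoc)
      then have "\<P>(\<omega> in M. ev y \<omega>) = (\<integral>\<omega>. q_path \<omega> x' (Suc k) * q_visit \<omega> z i' m y \<partial>E.env)"
        using Suc.IH[of x' "Suc k" i', OF x'(1)] unfolding x'(2) by (simp only:)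
      moreover have "q_path \<omega> x' (Suc k) = q_path \<omega> x k * step_prob (\<lambda>z. clip (\<omega> z)) (x k) y" for \<omega>
        by (simp add: path_prob_def x'_def)
      ultimately show ?thesis by (simp only: mult.assoc)
    qed
    have [measurable]: "Measurable.pred M (ev y)" for y unfolding ev_def by measurable
    have "\<P>(\<omega> in M. history x k \<omega> \<and> j \<le> visits z k (Suc m) \<omega>) =
        prob ({\<omega>\<in>space M. ev (x k + 1) \<omega>} \<union> {\<omega>\<in>space M. ev (x k - 1) \<omega>})"
      unfolding split
    proof (rule finite_measure_eq_AE)
      show "AE \<omega> in M. \<omega> \<in> {\<omega>\<in>space M. history x k \<omega> \<and> i' \<le> visits z (Suc k) m \<omega>} \<longleftrightarrow>
          \<omega> \<in> {\<omega>\<in>space M. ev (x k + 1) \<omega>} \<union> {\<omega>\<in>space M. ev (x k - 1) \<omega>}"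
        using nearest_neighbour[of k] by eventually_elim (auto simp: ev_def)
    qed measurable
    also have "\<dots> = \<P>(\<omega> in M. ev (x k + 1) \<omega>) + \<P>(\<omega> in M. ev (x k - 1) \<omega>)"
    proof (rule finite_measure_Union)
      have "\<not> (ev (x k + 1) \<omega> \<and> ev (x k - 1) \<omega>)" for \<omega>
        unfolding ev_def by linarith
      then show "{\<omega>\<in>space M. ev (x k + 1) \<omega>} \<inter> {\<omega>\<in>space M. ev (x k - 1) \<omega>} = {}" by blast
    qed measurable
    also have "\<dots> = (\<integral>\<omega>. q_path \<omega> x k * q_visit \<omega> z j (Suc m) (x k) \<partial>E.env)"
      unfolding ev_prob
    proof (subst Bochner_Integration.integral_add[symmetric])
      have *: "integrable E.env (\<lambda>\<omega>. q_path \<omega> x k * (step_prob (\<lambda>z. clip (\<omega> z)) (x k) y * q_visit \<omega> z i' m y))" for y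
      proof -
        have "q_path \<omega> x k * step_prob (\<lambda>z. clip (\<omega> z)) (x k) y = q_path \<omega> (x(Suc k := y)) (Suc k)" for \<omega>
          by (simp add: path_prob_def)
        then show ?thesis using q_integrable[of "x(Suc k := y)" "Suc k"] by (simp add: mult.assoc[symmetric])
      qed
      then show "integrable E.env (\<lambda>\<omega>. q_path \<omega> x k * (step_prob (\<lambda>z. clip (\<omega> z)) (x k) (x k + 1) * q_visit \<omega> z i' m (x k + 1)))"
        "integrable E.env (\<lambda>\<omega>. q_path \<omega> x k * (step_prob (\<lambda>z. clip (\<omega> z)) (x k) (x k - 1) * q_visit \<omega> z i' m (x k - 1)))"
        by blast+
    qed (simp add: j i'_def step_prob_def distrib_left)
    finally show ?thesis .
  qed
qed

text \<open>In almost every environment 0 is hit from any site, so averaging shows that almost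
  surely every history is followed by a visit to 0. Applying this at all times gives infinitely many
  visits.\<close>

lemma recurrent_if:
  assumes "lam \<le> 1"
  shows "recurrent M X"
proof -
  \<comment> \<open>On the positive sites the parameters are \<open>(lam + 1) / 2\<close> and 1,
    equal exactly at \<open>lam = 1\<close>.\<close>
  have right: "AE \<omega> in E.env. \<not> (\<lambda>n. \<Prod>i<n. odds \<omega> (int (Suc i))) \<longlonglongrightarrow> 0"
  proof (cases "lam = 1")
    case True
    then show ?thesis
      by (intro E.AE_prod_odds_equal) (auto simp: inj_def site_alpha_def site_beta_def)
  next
    case False
    then show ?thesis
      using assms by (intro E.AE_prod_odds_less[where \<alpha> = "(lam + 1) / 2" and \<beta> = 1])
        (auto simp: inj_def site_alpha_def site_beta_def)
  qed
  \<comment> \<open>On the negative sites \<open>(lam + 2) / 2 > 1 / 2\<close>, so the inverse odds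
    are the relevant products.\<close>
  have left: "AE \<omega> in E.env. \<not> (\<lambda>n. \<Prod>i<n. inverse (odds \<omega> (- int (Suc i)))) \<longlonglongrightarrow> 0"
    using E.AE_prod_odds_greater[of "\<lambda>i. - int (Suc i)" "(lam + 2) / 2" "1 / 2"] lam_nonneg
    by (auto simp: inj_def site_alpha_def site_beta_def)
  have limit: "AE \<omega> in E.env. \<forall>x. (\<lambda>m. q_visit \<omega> 0 1 m x) \<longlonglongrightarrow> 1"
    using right left
  proof eventually_elim
    case (elim \<omega>)
    show ?case
    proof
      fix x
      show "(\<lambda>m. q_visit \<omega> 0 1 m x) \<longlonglongrightarrow> 1"
        using elim by (intro interior_probs.visit_prob_tendsto_1 interior_probs_clip)
          (simp_all only: simp_thms One_nat_def prod.atLeast1_atMost_eq odds_def inverse_divide)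
    qed
  qed
  have "AE \<omega> in M. history x k \<omega> \<longrightarrow> (\<exists>i\<ge>k. X i \<omega> = 0)" for x k
  proof (cases "x 0 = 0")
    case False
    show ?thesis using start by eventually_elim (use False in auto)
  next
    case True
    let ?A = "\<lambda>m. {\<omega>\<in>space M. history x k \<omega> \<and> 1 \<le> visits 0 k m \<omega>}"
    let ?B = "{\<omega>\<in>space M. history x k \<omega> \<and> (\<exists>i\<ge>k. X i \<omega> = 0)}"
    have "(\<lambda>m. \<integral>\<omega>. q_path \<omega> x k * q_visit \<omega> 0 1 m (x k) \<partial>E.env) \<longlonglongrightarrow>
        (\<integral>\<omega>. q_path \<omega> x k * 1 \<partial>E.env)"
    proof (rule integral_dominated_convergence[where w = "\<lambda>_. 1"])
      show "AE \<omega> in E.env. (\<lambda>m. q_path \<omega> x k * q_visit \<omega> 0 1 m (x k)) \<longlonglongrightarrow> q_path \<omega> x k * 1"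
        using limit by eventually_elim (intro tendsto_intros, auto)
      show "AE \<omega> in E.env. norm (q_path \<omega> x k * q_visit \<omega> 0 1 m (x k)) \<le> 1" for m
        using q_path_bounds[of _ x k] q_visit_bounds[of _ 0 1 m "x k"]
        by (simp add: abs_mult mult_le_one del: One_nat_def)
    qed (simp_all del: One_nat_def)
    then have "(\<lambda>m. prob (?A m)) \<longlonglongrightarrow> \<P>(\<omega> in M. history x k \<omega>)"
      using prob_history[of x k, OF True] prob_history_visits[of x k 1 0, OF True] by simp
    moreover have "prob (?A m) \<le> prob ?B" for m
    proof (rule finite_measure_mono)
      show "?A m \<subseteq> ?B"
      proof safe
        fix \<omega> assume "1 \<le> visits 0 k m \<omega>"
        then have "visits 0 k m \<omega> \<noteq> 0" by (metis not_one_le_zero)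
        then obtain i where "i \<in> {k..k+m}" "X i \<omega> = 0"
          by (auto simp: of_bool_def split: if_splits)
        then show "\<exists>i\<ge>k. X i \<omega> = 0" by auto
      qed
    qed measurable
    ultimately have le: "\<P>(\<omega> in M. history x k \<omega>) \<le> prob ?B"
      by (intro LIMSEQ_le_const2) auto
    have "prob ({\<omega>\<in>space M. history x k \<omega>} - ?B) = \<P>(\<omega> in M. history x k \<omega>) - prob ?B"
      by (rule finite_measure_Diff) auto
    then have "prob ({\<omega>\<in>space M. history x k \<omega>} - ?B) = 0"
      using le measure_nonneg[of M "{\<omega>\<in>space M. history x k \<omega>} - ?B"] by linarith
    moreover have "{\<omega>\<in>space M. history x k \<omega>} - ?B =
        {\<omega>\<in>space M. \<not> (history x k \<omega> \<longrightarrow> (\<exists>i\<ge>k. X i \<omega> = 0))}" by auto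
    ultimately have "\<P>(\<omega> in M. \<not> (history x k \<omega> \<longrightarrow> (\<exists>i\<ge>k. X i \<omega> = 0))) = 0" by simp
    then show ?thesis
      by (subst (asm) prob_Collect_eq_0) auto
  qed
  \<comment> \<open>Finite lists encode the histories, so that the exceptional null sets form a
    countable family.\<close>
  then have "AE \<omega> in M. \<forall>k. \<forall>xs::int list. history (\<lambda>i. xs ! i) k \<omega> \<longrightarrow> (\<exists>i\<ge>k. X i \<omega> = 0)"
    unfolding AE_all_countable by blast
  then have "AE \<omega> in M. infinite {n. X n \<omega> = 0}"
  proof eventually_elim
    case (elim \<omega>)
    have "\<exists>i\<ge>k. X i \<omega> = 0" for k
      using elim[rule_format, where xs = "map (\<lambda>i. X i \<omega>) [0..<Suc k]" and k = k]
      by (simp del: upt_Suc)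
    then show ?case by (auto simp: infinite_nat_iff_unbounded_le)
  qed
  then show ?thesis by (simp add: recurrent_def)
qed

text \<open>Let \<open>H j\<close> be the probability, in a fixed environment, of at least
  \<open>j\<close> visits to \<open>z\<close> ever. It tends to 0 in almost every environment, so
  its mean does too, and infinitely many visits have probability 0.\<close>

lemma transient_if:
  assumes "lam > 1"
  shows "transient M X"
proof -
  have summable: "AE \<omega> in E.env. summable (\<lambda>n. \<Prod>i<n. odds \<omega> (int (Suc i)))"
    using E.AE_prod_odds_greater[of "\<lambda>i. int (Suc i)" "(lam + 1) / 2" "1"] assms
    by (auto simp: inj_def site_alpha_def site_beta_def)
  have "AE \<omega> in M. finite {n. X n \<omega> = z}" for z
  proof -
    define H where "H j \<omega> = lim (\<lambda>m. q_visit \<omega> z j m 0)" for j \<omega>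
    have H: "(\<lambda>m. q_visit \<omega> z j m 0) \<longlonglongrightarrow> H j \<omega>" for j \<omega>
      unfolding H_def convergent_LIMSEQ_iff[symmetric]
    proof (rule Bseq_monoseq_convergent)
      show "Bseq (\<lambda>m. q_visit \<omega> z j m 0)"
        using q_visit_bounds[of \<omega> z j _ 0] by (intro BseqI'[of _ 1]) auto
      show "monoseq (\<lambda>m. q_visit \<omega> z j m 0)"
        using interior_probs.visit_prob_Suc_mono[OF interior_probs_clip]
        by (intro incseq_imp_monoseq incseq_SucI)
    qed
    have H_meas [measurable]: "H j \<in> borel_measurable E.env" for j
      unfolding H_def by measurable
    have H_bounds: "H j \<omega> \<in> {0..1}" for j \<omega>
      by (rule closed_sequentially[OF _ _ H]) (use q_visit_bounds in auto)
    \<comment> \<open>The constant \<open>C\<close> depends on the environment but not on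
      \<open>j\<close>, whence \<open>H j \<omega> \<le> C / j\<close>.\<close>
    have "AE \<omega> in E.env. (\<lambda>j. H j \<omega>) \<longlonglongrightarrow> 0"
      using summable
    proof eventually_elim
      case (elim \<omega>)
      obtain C where C: "real j * q_visit \<omega> z j m x \<le> C" for j m x
        using interior_probs.visit_prob_bound[OF interior_probs_clip, of \<omega> z] elim
        by (auto simp: prod.atLeast1_atMost_eq odds_def)
      have upper: "H j \<omega> \<le> C / real j" if "j \<ge> 1" for j
        by (rule LIMSEQ_le_const2[OF H]) (use C[of j] that in \<open>auto simp: field_simps\<close>)
      show ?case
      proof (rule tendsto_sandwich[of "\<lambda>_. 0" _ _ "\<lambda>j. C / real j"])
        show "\<forall>\<^sub>F j in sequentially. 0 \<le> H j \<omega>" using H_bounds by simp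
        show "\<forall>\<^sub>F j in sequentially. H j \<omega> \<le> C / real j"
          using eventually_ge_at_top[of 1] by eventually_elim (rule upper)
        show "(\<lambda>j. C / real j) \<longlonglongrightarrow> 0" by real_asymp
      qed simp
    qed
    then have int_H: "(\<lambda>j. \<integral>\<omega>. H j \<omega> \<partial>E.env) \<longlonglongrightarrow> (\<integral>\<omega>. 0 \<partial>E.env)"
      by (intro integral_dominated_convergence[where w = "\<lambda>_. 1"]) (use H_bounds in auto)
    define B where "B j = {\<omega>\<in>space M. \<exists>m. j \<le> visits z 0 m \<omega>}" for j
    have B_sets [measurable]: "B j \<in> events" for j unfolding B_def by measurable
    have B_prob: "prob (B j) = (\<integral>\<omega>. H j \<omega> \<partial>E.env)" for j
    proof -
      let ?A = "\<lambda>m. {\<omega>\<in>space M. j \<le> visits z 0 m \<omega>}"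
      have "?A m \<subseteq> ?A (Suc m)" for m by auto
      then have "incseq ?A" by (rule incseq_SucI)
      then have "(\<lambda>m. prob (?A m)) \<longlonglongrightarrow> prob (\<Union>m. ?A m)"
        by (intro finite_Lim_measure_incseq) auto
      moreover have "(\<Union>m. ?A m) = B j" by (auto simp: B_def)
      moreover have "prob (?A m) = (\<integral>\<omega>. q_visit \<omega> z j m 0 \<partial>E.env)" for m
      proof -
        \<comment> \<open>The start at 0 makes the time-0 history almost sure, and its
          \<open>q_path\<close> is an empty product.\<close>
        have "prob (?A m) = \<P>(\<omega> in M. history (\<lambda>_. 0) 0 \<omega> \<and> j \<le> visits z 0 m \<omega>)"
          using start by (intro finite_measure_eq_AE) (auto elim!: eventually_mono)
        also have "\<dots> = (\<integral>\<omega>. q_visit \<omega> z j m 0 \<partial>E.env)"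
          using prob_history_visits[of "\<lambda>_. 0" 0 j z m] by (simp add: path_prob_def)
        finally show ?thesis .
      qed
      moreover have "(\<lambda>m. \<integral>\<omega>. q_visit \<omega> z j m 0 \<partial>E.env) \<longlonglongrightarrow> (\<integral>\<omega>. H j \<omega> \<partial>E.env)"
        using q_visit_bounds H
        by (intro integral_dominated_convergence[where w = "\<lambda>_. 1"]) auto
      ultimately show ?thesis using LIMSEQ_unique by auto
    qed
    have "prob (\<Inter>j. B j) \<le> prob (B j)" for j by (intro finite_measure_mono) auto
    then have "prob (\<Inter>j. B j) \<le> 0"
      using int_H unfolding B_prob by (intro LIMSEQ_le_const[OF int_H[simplified]]) auto
    then have "prob (\<Inter>j. B j) = 0" using measure_nonneg[of M "\<Inter>j. B j"] by linarith
    then have "AE \<omega> in M. \<omega> \<notin> (\<Inter>j. B j)"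
      by (subst (asm) prob_eq_0) auto
    then show ?thesis
      using AE_space
    proof eventually_elim
      case (elim \<omega>)
      then obtain j where j: "\<And>m. \<not> j \<le> visits z 0 m \<omega>" by (auto simp: B_def)
      show "finite {n. X n \<omega> = z}"
      proof (rule ccontr)
        assume "infinite {n. X n \<omega> = z}"
        then obtain S where S: "S \<subseteq> {n. X n \<omega> = z}" "finite S" "card S = j"
          using infinite_arbitrarily_large by blast
        have "j = (\<Sum>i\<in>S. of_bool (X i \<omega> = z))" using S by (auto simp: Int_absorb2)
        \<comment> \<open>A horizon reaching the last of the \<open>j\<close> chosen visit times;
          inserting 0 keeps \<open>Max\<close> defined when \<open>S\<close> is empty.\<close>
        also have "\<dots> \<le> visits z 0 (Max (insert 0 S)) \<omega>"
          using S(2) by (intro sum_mono2) auto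
        finally show False using j by blast
      qed
    qed
  qed
  then show ?thesis by (simp add: transient_def AE_all_countable)
qed

end

theorem theorem6p7:
  fixes M :: "'a measure" and lam :: real and X :: "nat \<Rightarrow> 'a \<Rightarrow> int"
  assumes "lam \<ge> 0"
    and "biased_errw M lam X"
  shows "(lam \<le> 1 \<longrightarrow> recurrent M X) \<and> (lam > 1 \<longrightarrow> transient M X)"
proof -
  interpret errw M lam X
    using assms by (simp add: errw_def errw_axioms_def)
  show ?thesis using recurrent_if transient_if by blast
qed

end
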